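(* For any integer $n\ge2$, with $d_k=\gcd(n,k)$ for $k=2,3$, $$[\mathbb{D}_{2n}^d]\circledcirc[\mathbb{T}\oplus\mathbb{Z}_2^c]=\{[\mathbb{1}],[\mathbb{Z}_2],[\mathbb{Z}_{d_3}],[\mathbb{D}_{d_2}],[\mathbb{Z}_2^-],[\mathbb{D}_2^z]\}.$$
   Context: $[K]$ is the conjugacy class of a subgroup $K$ in $\mathrm{O}(3)$, and the clips operation is $[H_1]\circledcirc[H_2]=\{[H_1\cap gH_2g^{-1}]:g\in\mathrm{O}(3)\}$. $(e_1,e_2,e_3)$ is the canonical basis of $\mathbb{R}^3$, $\mathbf{r}(n,\theta)$ is the rotation by angle $\theta$ about the axis directed by $n\neq0$. $\mathbb{1}=\{\mathrm{Id}\}$; $\mathbb{Z}_2^c=\{\pm\mathrm{Id}\}$; $H\oplus\mathbb{Z}_2^c=H\cup(-H)$ for $H\subset\mathrm{SO}(3)$; $\mathbb{Z}_k=\{\mathbf{r}(e_3,2j\pi/k):0\le j\le k-1\}$; $\mathbb{D}_k=\langle\mathbf{r}(e_3,2\pi/k),\mathbf{r}(e_1,\pi)\rangle$ for $k\ge2$; $\mathbb{Z}_2^-=\{\mathrm{Id},-\mathbf{r}(e_3,\pi)\}$; $\mathbb{D}_2^z=\mathbb{Z}_2\cup(-\mathbf{r}(e_1,\pi))\mathbb{Z}_2$; $\mathbb{D}_{2k}^d=\mathbb{D}_k\cup(-\mathbf{r}(e_3,\pi/k))\mathbb{D}_k$ (the superscript $d$ is part of the name). $\mathbb{T}$ is the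 rotation group of the regular tetrahedron (order 12), generated by $\mathbf{r}(e_3,\pi),\mathbf{r}(e_1,\pi),\mathbf{r}(e_1+e_2+e_3,2\pi/3)$. Conventions: $[\mathbb{Z}_1]=[\mathbb{1}]$, $[\mathbb{D}_1]=[\mathbb{Z}_2]$. *)

theory Defs
  imports "HOL-Analysis.Analysis" "HOL-Algebra.Coset" "HOL-Algebra.Generated_Groups"
begin

unbundle cross3_syntax

type_synonym mat3 = "real^3^3"

definition O3 :: "mat3 monoid" where
  "O3 = \<lparr>carrier = {A. orthogonal_matrix A}, mult = (**), one = mat 1\<rparr>"

abbreviation e1 :: "real^3" where "e1 \<equiv> axis 1 1"
abbreviation e2 :: "real^3" where "e2 \<equiv> axis 2 1"
abbreviation e3 :: "real^3" where "e3 \<equiv> axis 3 1"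

text \<open>Rodrigues' formula for the rotation by \<open>\<theta>\<close> about the axis directed by \<open>n\<close>
  (right-hand rule); only meaningful for \<open>n \<noteq> 0\<close>.\<close>
definition rotation :: "real^3 \<Rightarrow> real \<Rightarrow> mat3" where
  "rotation n \<theta> = matrix (\<lambda>x. let u = n /\<^sub>R norm n in
     cos \<theta> *\<^sub>R x + sin \<theta> *\<^sub>R (u \<times> x) + ((1 - cos \<theta>) * (u \<bullet> x)) *\<^sub>R u)"

definition conj_by :: "mat3 \<Rightarrow> mat3 set \<Rightarrow> mat3 set" where
  "conj_by g K = g <#\<^bsub>O3\<^esub> K #>\<^bsub>O3\<^esub> inv\<^bsub>O3\<^esub> g"

definition conj_class :: "mat3 set \<Rightarrow> mat3 set set" where
  "conj_class K = {conj_by g K | g. g \<in> carrier O3}"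

text \<open>The clips operation acts on conjugacy classes, so it is defined by letting the
  representatives range over the whole classes; \<open>clips_conj_class\<close> below shows that this is
  the usual formula in terms of any fixed pair of representatives.\<close>
definition clips :: "mat3 set set \<Rightarrow> mat3 set set \<Rightarrow> mat3 set set set"
    (infixl \<open>\<circledcirc>\<close> 65) where
  "C1 \<circledcirc> C2 =
     {conj_class (H1 \<inter> conj_by g H2) | H1 H2 g. H1 \<in> C1 \<and> H2 \<in> C2 \<and> g \<in> carrier O3}"

definition trivial_group :: "mat3 set" where
  "trivial_group = {mat 1}"

definition oplus_Z2c :: "mat3 set \<Rightarrow> mat3 set" where
  "oplus_Z2c H = H \<union> uminus ` H"

definition Z_grp :: "nat \<Rightarrow> mat3 set" where
  "Z_grp k = {rotation e3 (2 * real j * pi / real k) | j. j < k}"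

text \<open>The usual generators are for \<open>k \<ge> 2\<close>; by convention the class of \<open>D_grp 1\<close> is that of
  \<open>Z_grp 2\<close>, and \<open>D_grp 0\<close> has no meaning.\<close>
definition D_grp :: "nat \<Rightarrow> mat3 set" where
  "D_grp k = (if k = 1 then Z_grp 2
          else generate O3 {rotation e3 (2 * pi / real k), rotation e1 pi})"

definition Z2_minus :: "mat3 set" where
  "Z2_minus = {mat 1, - rotation e3 pi}"

definition D2_z :: "mat3 set" where
  "D2_z = Z_grp 2 \<union> ((- rotation e1 pi) <#\<^bsub>O3\<^esub> Z_grp 2)"

text \<open>The argument is half of the traditional index: \<open>D_d_grp k\<close> is the group written with
  subscript \<open>2k\<close> and superscript \<open>d\<close>, of order \<open>4k\<close>.\<close>
definition D_d_grp :: "nat \<Rightarrow> mat3 set" where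
  "D_d_grp k = D_grp k \<union> ((- rotation e3 (pi / real k)) <#\<^bsub>O3\<^esub> D_grp k)"

definition T_grp :: "mat3 set" where
  "T_grp = generate O3 {rotation e3 pi, rotation e1 pi, rotation (e1 + e2 + e3) (2 * pi / 3)}"

lemma carrier_O3 [simp]: "A \<in> carrier O3 \<longleftrightarrow> orthogonal_matrix A"
  and mult_O3 [simp]: "mult O3 = (**)"
  and one_O3 [simp]: "one O3 = mat 1"
  by (simp_all add: O3_def)

lemma group_O3: "group O3"
proof (rule groupI)
  fix A assume "A \<in> carrier O3"
  then show "\<exists>B\<in>carrier O3. B \<otimes>\<^bsub>O3\<^esub> A = \<one>\<^bsub>O3\<^esub>"
    by (intro bexI[of _ "transpose A"]) (auto simp: orthogonal_matrix_def)
qed (auto simp: orthogonal_matrix_mul orthogonal_matrix_id matrix_mul_assoc)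

interpretation O3: group O3
  by (rule group_O3)

lemma conj_by_conj_by:
  assumes "g \<in> carrier O3" "h \<in> carrier O3" "K \<subseteq> carrier O3"
  shows "conj_by g (conj_by h K) = conj_by (g \<otimes>\<^bsub>O3\<^esub> h) K"
proof -
  have "conj_by a L = (\<lambda>x. a \<otimes>\<^bsub>O3\<^esub> x \<otimes>\<^bsub>O3\<^esub> inv\<^bsub>O3\<^esub> a) ` L" for a L
    by (auto simp: conj_by_def l_coset_def r_coset_def)
  then show ?thesis
    using assms
    by (simp add: image_image O3.m_assoc O3.inv_mult_group subset_iff
        del: carrier_O3 mult_O3 cong: image_cong_simp)
qed

lemma conj_by_subset:
  assumes "g \<in> carrier O3" "K \<subseteq> carrier O3"
  shows "conj_by g K \<subseteq> carrier O3"
  unfolding conj_by_def using assms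
  by (meson O3.inv_closed O3.l_coset_subset_G O3.r_coset_subset_G)

lemma conj_by_one: "K \<subseteq> carrier O3 \<Longrightarrow> conj_by \<one>\<^bsub>O3\<^esub> K = K"
  unfolding conj_by_def
  by (simp add: O3.coset_mult_one O3.lcos_mult_one del: one_O3)

lemma conj_by_Int:
  assumes "g \<in> carrier O3" "H \<subseteq> carrier O3" "K \<subseteq> carrier O3"
  shows "conj_by g (H \<inter> K) = conj_by g H \<inter> conj_by g K"
proof -
  have *: "conj_by g L = (\<lambda>x. g \<otimes>\<^bsub>O3\<^esub> x \<otimes>\<^bsub>O3\<^esub> inv\<^bsub>O3\<^esub> g) ` L" for L
    by (auto simp: conj_by_def l_coset_def r_coset_def)
  have "inj_on (\<lambda>x. g \<otimes>\<^bsub>O3\<^esub> x \<otimes>\<^bsub>O3\<^esub> inv\<^bsub>O3\<^esub> g) (carrier O3)"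
    using assms(1) by (auto simp: inj_on_def simp del: carrier_O3 mult_O3)
  then show ?thesis
    unfolding * using assms(2,3) by (rule inj_on_image_Int)
qed

lemma conj_class_conj_by:
  assumes g: "g \<in> carrier O3" and K: "K \<subseteq> carrier O3"
  shows "conj_class (conj_by g K) = conj_class K"
proof (intro equalityI subsetI)
  fix L assume "L \<in> conj_class (conj_by g K)"
  then obtain a where "a \<in> carrier O3" "L = conj_by a (conj_by g K)"
    by (auto simp: conj_class_def simp del: carrier_O3)
  then show "L \<in> conj_class K"
    using g K O3.m_closed unfolding conj_class_def
    by (auto simp: conj_by_conj_by simp del: carrier_O3 mult_O3)
next
  fix L assume "L \<in> conj_class K"
  then obtain a where a: "a \<in> carrier O3" "L = conj_by a K"
    by (auto simp: conj_class_def simp del: carrier_O3)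
  have "L = conj_by (a \<otimes>\<^bsub>O3\<^esub> inv\<^bsub>O3\<^esub> g) (conj_by g K)"
    using a g K by (simp add: conj_by_conj_by O3.m_assoc del: carrier_O3 mult_O3 one_O3)
  then show "L \<in> conj_class (conj_by g K)"
    using a g O3.m_closed O3.inv_closed unfolding conj_class_def by blast
qed

lemma clips_conj_class:
  assumes H1: "H1 \<subseteq> carrier O3" and H2: "H2 \<subseteq> carrier O3"
  shows "conj_class H1 \<circledcirc> conj_class H2 =
           {conj_class (H1 \<inter> conj_by g H2) | g. g \<in> carrier O3}"
proof (intro equalityI subsetI)
  fix C assume "C \<in> conj_class H1 \<circledcirc> conj_class H2"
  then obtain a b g where abg: "a \<in> carrier O3" "b \<in> carrier O3" "g \<in> carrier O3"
    and C: "C = conj_class (conj_by a H1 \<inter> conj_by g (conj_by b H2))"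
    unfolding clips_def conj_class_def by blast
  define h where "h = inv\<^bsub>O3\<^esub> a \<otimes>\<^bsub>O3\<^esub> (g \<otimes>\<^bsub>O3\<^esub> b)"
  have h: "h \<in> carrier O3"
    using abg unfolding h_def by (metis O3.inv_closed O3.m_closed)
  have "a \<otimes>\<^bsub>O3\<^esub> h = g \<otimes>\<^bsub>O3\<^esub> b"
    using abg unfolding h_def by (simp add: O3.m_assoc[symmetric] del: carrier_O3 mult_O3 one_O3)
  then have "conj_by g (conj_by b H2) = conj_by a (conj_by h H2)"
    using abg h H2 by (simp add: conj_by_conj_by del: carrier_O3 mult_O3)
  then have "C = conj_class (conj_by a (H1 \<inter> conj_by h H2))"
    using C abg h H1 H2 by (simp add: conj_by_Int conj_by_subset del: carrier_O3)
  also have "\<dots> = conj_class (H1 \<inter> conj_by h H2)"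
    using abg H1 by (intro conj_class_conj_by) auto
  finally show "C \<in> {conj_class (H1 \<inter> conj_by g H2) | g. g \<in> carrier O3}"
    using h by blast
next
  fix C assume "C \<in> {conj_class (H1 \<inter> conj_by g H2) | g. g \<in> carrier O3}"
  moreover have "K \<in> conj_class K" if "K \<subseteq> carrier O3" for K
    using conj_by_one[OF that] O3.one_closed unfolding conj_class_def
    by (metis (mono_tags, lifting) mem_Collect_eq)
  ultimately show "C \<in> conj_class H1 \<circledcirc> conj_class H2"
    using H1 H2 unfolding clips_def by blast
qed

lemma rotation_mult_vec:
  fixes n x :: "real^3"
  defines "u \<equiv> n /\<^sub>R norm n"
  shows "rotation n \<theta> *v x =
    cos \<theta> *\<^sub>R x + sin \<theta> *\<^sub>R (u \<times> x) + ((1 - cos \<theta>) * (u \<bullet> x)) *\<^sub>R u"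
proof -
  have "linear (\<lambda>x. cos \<theta> *\<^sub>R x + sin \<theta> *\<^sub>R (u \<times> x) + ((1 - cos \<theta>) * (u \<bullet> x)) *\<^sub>R u)"
    by (rule linearI) (simp_all add: cross_add_right cross_mult_right algebra_simps inner_add_right)
  then show ?thesis
    unfolding rotation_def Let_def u_def by simp
qed

lemma rotation_in_O3:
  assumes "n \<noteq> 0"
  shows "rotation n \<theta> \<in> carrier O3"
proof -
  define u where "u = n /\<^sub>R norm n"
  have u: "u \<bullet> u = 1"
    using assms by (simp add: u_def dot_square_norm power2_eq_square)
  have cc: "(u \<times> x) \<bullet> (u \<times> x) = x \<bullet> x - (u \<bullet> x)\<^sup>2" for x
    using norm_cross_dot[of u x] u
    by (simp add: power2_norm_eq_inner power_mult_distrib)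
  have "(rotation n \<theta> *v x) \<bullet> (rotation n \<theta> *v x) = x \<bullet> x" for x
  proof -
    define c s p where "c = cos \<theta>" and "s = sin \<theta>" and "p = u \<bullet> x"
    have cs: "s\<^sup>2 = 1 - c\<^sup>2"
      by (simp add: c_def s_def sin_squared_eq)
    have "(c *\<^sub>R x + s *\<^sub>R (u \<times> x) + ((1 - c) * p) *\<^sub>R u) \<bullet>
          (c *\<^sub>R x + s *\<^sub>R (u \<times> x) + ((1 - c) * p) *\<^sub>R u) =
          c\<^sup>2 * (x \<bullet> x) + s\<^sup>2 * (x \<bullet> x - p\<^sup>2) + ((1 - c) * p)\<^sup>2 + 2 * c * (1 - c) * p\<^sup>2"
      by (simp add: cc u p_def inner_add_left inner_add_right dot_cross_self inner_commute
          power2_eq_square algebra_simps)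
    also have "\<dots> = x \<bullet> x"
      unfolding cs by (simp add: power2_eq_square algebra_simps)
    finally show ?thesis
      by (simp add: rotation_mult_vec u_def c_def s_def p_def)
  qed
  then have "orthogonal_transformation ((*v) (rotation n \<theta>))"
    by (simp add: orthogonal_transformation norm_eq_sqrt_inner)
  then show ?thesis
    by (simp add: orthogonal_transformation_matrix)
qed

lemma uminus_in_O3: "A \<in> carrier O3 \<Longrightarrow> - A \<in> carrier O3"
proof -
  assume "A \<in> carrier O3"
  moreover have "transpose (- A) ** (- A) = transpose A ** A"
    by (simp add: matrix_matrix_mult_def transpose_def vec_eq_iff)
  ultimately show ?thesis
    by (simp add: orthogonal_matrix)
qed

lemma e1_plus_e2_plus_e3_nonzero: "e1 + e2 + e3 \<noteq> 0"
  by (simp add: vec_eq_iff forall_3 axis_def)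

lemma subgroup_T: "subgroup T_grp O3"
  unfolding T_grp_def using e1_plus_e2_plus_e3_nonzero
  by (intro O3.generate_is_subgroup) (auto intro!: rotation_in_O3 simp del: carrier_O3)

lemma Z_subset_O3: "Z_grp k \<subseteq> carrier O3"
  by (auto simp: Z_grp_def intro!: rotation_in_O3 simp del: carrier_O3)

lemma D_subset_O3: "D_grp k \<subseteq> carrier O3"
proof (cases "k = 1")
  case False
  have "subgroup (generate O3 {rotation e3 (2 * pi / real k), rotation e1 pi}) O3"
    by (intro O3.generate_is_subgroup) (auto intro!: rotation_in_O3 simp del: carrier_O3)
  then show ?thesis
    using False subgroup.subset by (auto simp: D_grp_def simp del: carrier_O3)
qed (use Z_subset_O3 in \<open>simp add: D_grp_def\<close>)

lemma D_d_subset_O3: "D_d_grp k \<subseteq> carrier O3"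
proof -
  have "- rotation e3 (pi / real k) \<in> carrier O3"
    by (intro uminus_in_O3 rotation_in_O3) simp
  then show ?thesis
    unfolding D_d_grp_def using D_subset_O3 O3.l_coset_subset_G by (meson Un_least)
qed

lemma oplus_Z2c_T_subset_O3: "oplus_Z2c T_grp \<subseteq> carrier O3"
  using subgroup.subset[OF subgroup_T] uminus_in_O3
  by (auto simp: oplus_Z2c_def simp del: carrier_O3)

end

theory Submission
  imports Defs
begin

text \<open>Write \<open>H\<close> for an intersection of the dihedral-type group \<open>D_d_grp n\<close>
  with a conjugate, by \<open>g\<close>, of the tetrahedral group extended by \<open>- mat
  1\<close>. Conjugating \<open>H\<close> back by \<open>g\<close> gives a subgroup of the fixed
  group \<open>oplus_Z2c T_grp\<close>, called \<open>pullback n g\<close> below. It is a good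
  place to compute, because \<open>oplus_Z2c T_grp\<close> is exactly the group of the 24 matrices
  obtained from a cyclic permutation matrix by changing signs of entries
  (\<open>oplus_Z2c_T\<close>). On the other side, \<open>D_d_grp n\<close> consists of the powers
  of \<open>- r(e3, \<pi>/n)\<close>, each possibly multiplied by the half-turn about
  \<open>e1\<close> (\<open>D_d_grp_dihedral\<close>). Three invariants of these elements do all
  the work: trace, determinant, and the fact that they send \<open>e3\<close> to
  \<open>\<plusminus> e3\<close>.

  Every intersection is in the list. If the cyclic part of some element of \<open>pullback n
  g\<close> is nontrivial, that element has trace \<open>0\<close>; in \<open>D_d_grp n\<close>
  only the two rotations by \<open>\<plusminus> 2\<pi>/3\<close> about \<open>e3\<close> have
  trace \<open>0\<close>, and they occur only if \<open>3\<close> divides \<open>n\<close>.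
  Multiplying any other element by this one shows that nothing else can occur, so the class is
  that of \<open>Z_grp 3\<close> (\<open>pullback_order_3\<close>). Otherwise \<open>pullback n
  g\<close> consists of diagonal sign matrices: the identity, the half-turns about the coordinate
  axes, and their negatives. Since \<open>- mat 1\<close> is not in \<open>D_d_grp n\<close>, each
  axis contributes at most one element, and two axes determine the third. This leaves the trivial
  group, the two groups of order 2, the group of all half-turns, and the groups with one half-turn
  and two reflections. The group of all half-turns requires \<open>n\<close> to be even
  (\<open>even_if_all_half_turns\<close>).

  Every class in the list occurs. The vector \<open>v = transpose g *v e3\<close>, that is, the
  third axis seen from the tetrahedral frame, is an eigenvector with eigenvalue
  \<open>\<plusminus> 1\<close> of every element of \<open>pullback n g\<close>
  (\<open>pullback_axis\<close>). A \<open>v\<close> with suitable coordinates therefore excludes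
  all unwanted elements, and a rotation about \<open>e3\<close> that carries an axis of the
  tetrahedral frame to an axis of \<open>D_d_grp n\<close> supplies the wanted ones. For the class
  of \<open>Z_grp 3\<close> the frame is turned so that a diagonal of the cube lies along
  \<open>e3\<close>.\<close>

section \<open>Rotations and conjugation in coordinates\<close>

lemma rotation_e3:
  "rotation e3 t = vector [vector [cos t, - sin t, 0], vector [sin t, cos t, 0], vector [0, 0, 1]]"
  unfolding rotation_def norm_axis_1 Let_def
  by (simp add: matrix_def vec_eq_iff forall_3 cross3_def inner_vec_def sum_3 axis_def)

lemma rotation_e1_pi:
  "rotation e1 pi = vector [vector [1, 0, 0], vector [0, -1, 0], vector [0, 0, -1]]"
  unfolding rotation_def norm_axis_1 Let_def
  by (simp add: matrix_def vec_eq_iff forall_3 cross3_def inner_vec_def sum_3 axis_def)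

lemma rotation_diagonal:
  "rotation (e1 + e2 + e3) (2 * pi / 3) = vector [vector [0, 0, 1], vector [1, 0, 0], vector [0, 1, 0]]"
proof -
  have n: "norm (e1 + e2 + e3) = sqrt 3"
    by (simp add: norm_eq_sqrt_inner inner_vec_def sum_3 axis_def)
  define u where "u = (e1 + e2 + e3) /\<^sub>R norm (e1 + e2 + e3)"
  have u: "u = (\<chi> i. 1 / sqrt 3)"
    unfolding u_def n by (simp add: vec_eq_iff forall_3 axis_def inverse_eq_divide)
  have s: "sin (2 * pi / 3) = sqrt 3 / 2" "cos (2 * pi / 3) = - 1 / 2"
    using sin_120 cos_120 by (simp_all add: mult.commute)
  have 3: "sqrt 3 * (2 * sqrt 3) = 6" by simp
  show ?thesis
    unfolding rotation_def Let_def u_def[symmetric] u s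
    by (simp add: matrix_def vec_eq_iff forall_3 cross3_def inner_vec_def sum_3 axis_def 3)
qed

lemma uminus_matrix_mult [simp]:
  fixes A B :: mat3
  shows "(- A) ** B = - (A ** B)" and "A ** (- B) = - (A ** B)"
  by (simp_all add: matrix_matrix_mult_def vec_eq_iff sum_negf)

lemma inv_O3: "orthogonal_matrix A \<Longrightarrow> inv\<^bsub>O3\<^esub> A = transpose A"
  by (rule O3.inv_equality) (auto simp: orthogonal_matrix_def)

lemma conj_by_image: "orthogonal_matrix g \<Longrightarrow> conj_by g K = (\<lambda>A. g ** A ** transpose g) ` K"
  by (auto simp: conj_by_def l_coset_def r_coset_def inv_O3)

lemma mult_conj:
  fixes g A B :: mat3
  shows "orthogonal_matrix g \<Longrightarrow> (g ** A ** transpose g) ** (g ** B ** transpose g) = g ** (A ** B) ** transpose g"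
proof -
  assume "orthogonal_matrix g"
  then have 1: "transpose g ** g = mat 1"
    by (simp add: orthogonal_matrix)
  have "(g ** A ** transpose g) ** (g ** B ** transpose g)
      = g ** A ** (transpose g ** g) ** B ** transpose g"
    by (simp only: matrix_mul_assoc)
  then show ?thesis
    by (simp add: 1 matrix_mul_assoc)
qed

lemma trace_scaleR: "trace (c *\<^sub>R A) = c * trace (A :: mat3)"
  by (simp add: trace_def sum_distrib_left)

lemma det_scaleR: "det (c *\<^sub>R A) = c ^ 3 * det (A :: mat3)"
  by (simp add: det_3 power3_eq_cube algebra_simps)

lemma trace_conj: "orthogonal_matrix g \<Longrightarrow> trace (g ** A ** transpose g) = trace (A :: mat3)"
  using trace_mul_sym[of "g ** A" "transpose g"] by (simp add: matrix_mul_assoc orthogonal_matrix)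

lemma det_conj: "orthogonal_matrix g \<Longrightarrow> det (g ** A ** transpose g) = det (A :: mat3)"
  using det_orthogonal_matrix[of g] by (auto simp: det_mul)

lemma uminus_mult_vec:
  fixes A :: mat3
  shows "(- A) *v x = - (A *v x)"
  by (simp add: matrix_vector_mult_def vec_eq_iff sum_negf)

lemma mult_vec_uminus:
  fixes A :: mat3
  shows "A *v (- x) = - (A *v x)"
  by (simp add: matrix_vector_mult_def vec_eq_iff sum_negf)

lemma mult_transpose_e3: "(transpose A *v e3) $ i = A $ 3 $ i"
  by (simp add: matrix_vector_mult_basis column_def transpose_def del: transpose_matrix_vector)

section \<open>The extended tetrahedral group as signed cyclic permutations\<close>

text \<open>Adding indices in the type \<open>3\<close> is addition modulo 3, so \<open>k\<close> is the
  cyclic permutation and \<open>s i\<close> the entry in row \<open>i\<close>. With this encoding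
  products reduce to \<open>monomial_mult\<close>, and no \<open>3 \<times> 3\<close> product has
  to be expanded.\<close>
definition monomial :: "(3 \<Rightarrow> real) \<Rightarrow> 3 \<Rightarrow> mat3" where
  "monomial s k = (\<chi> i j. if j = i + k then s i else 0)"

lemma monomial_mult: "monomial s k ** monomial t l = monomial (\<lambda>i. s i * t (i + k)) (k + l)"
  by (simp add: monomial_def matrix_matrix_mult_def vec_eq_iff if_distrib[of "\<lambda>x. x * _"] add.assoc
       cong: if_cong)

lemma transpose_monomial: "transpose (monomial s k) = monomial (\<lambda>i. s (i - k)) (- k)"
  by (auto simp: monomial_def transpose_def vec_eq_iff)

lemma mat_1_monomial: "mat 1 = monomial (\<lambda>_. 1) 0"
  by (auto simp: monomial_def mat_def vec_eq_iff)

lemma uminus_monomial: "- monomial s k = monomial (\<lambda>i. - s i) k"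
  by (auto simp: monomial_def vec_eq_iff)

lemma monomial_mult_vec: "monomial s k *v x = (\<chi> i. s i * x $ (i + k))"
  by (simp add: monomial_def matrix_vector_mult_def vec_eq_iff if_distrib[of "\<lambda>x. x * _"]
       cong: if_cong)

definition axis_signs :: "3 \<Rightarrow> 3 \<Rightarrow> real" where
  "axis_signs i j = (if j = i then 1 else - 1)"

definition half_turn :: "3 \<Rightarrow> mat3" where
  "half_turn i = monomial (axis_signs i) 0"

lemma rotation_e1_half_turn: "rotation e1 pi = half_turn 1"
  by (simp add: rotation_e1_pi half_turn_def monomial_def axis_signs_def vec_eq_iff forall_3)

lemma rotation_e3_half_turn: "rotation e3 pi = half_turn 3"
  by (simp add: rotation_e3 half_turn_def monomial_def axis_signs_def vec_eq_iff forall_3)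

lemma rotation_diagonal_monomial: "rotation (e1 + e2 + e3) (2 * pi / 3) = monomial (\<lambda>_. 1) 2"
  by (simp add: rotation_diagonal half_turn_def monomial_def axis_signs_def vec_eq_iff forall_3)

definition signs :: "(3 \<Rightarrow> real) set" where
  "signs = {s. \<forall>i. s i = 1 \<or> s i = - 1}"

lemma signs_cases:
  assumes "s \<in> signs"
  obtains (one) "s = (\<lambda>_. 1)" | (minus_one) "s = (\<lambda>_. - 1)"
  | (axis) i where "s = axis_signs i" | (minus_axis) i where "s = (\<lambda>j. - axis_signs i j)"
proof -
  have ex_3: "(\<exists>i. P i) \<longleftrightarrow> P 1 \<or> P 2 \<or> P 3" for P :: "3 \<Rightarrow> bool"
    by (metis exhaust_3)
  have "s = (\<lambda>_. 1) \<or> s = (\<lambda>_. - 1) \<or> (\<exists>i. s = axis_signs i) \<or> (\<exists>i. s = (\<lambda>j. - axis_signs i j))"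
    using assms by (auto simp: signs_def fun_eq_iff forall_3 ex_3 axis_signs_def)
  then show thesis
    using that by blast
qed

lemma diagonal_cases:
  assumes "s \<in> signs"
  obtains "monomial s 0 = mat 1" | "monomial s 0 = - mat 1"
  | i where "monomial s 0 = half_turn i" | i where "monomial s 0 = - half_turn i"
  using assms
  by (cases rule: signs_cases)
    (simp_all add: mat_1_monomial half_turn_def uminus_monomial)

text \<open>The indices \<open>1, 2, 3\<close> add up to \<open>0\<close> modulo 3, so \<open>- i -
  j\<close> is the index different from both \<open>i\<close> and \<open>j\<close>.\<close>
lemma half_turn_mult:
  "half_turn i ** half_turn j = (if i = j then mat 1 else half_turn (- i - j))"
proof -
  have "(\<lambda>k. axis_signs i k * axis_signs j k) = (if i = j then \<lambda>_. 1 else axis_signs (- i - j))"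
    using exhaust_3[of i] exhaust_3[of j] by (auto simp: axis_signs_def fun_eq_iff forall_3)
  then show ?thesis
    by (simp add: half_turn_def monomial_mult mat_1_monomial)
qed

lemma orthogonal_monomial: "s \<in> signs \<Longrightarrow> orthogonal_matrix (monomial s k)"
  by (auto simp: orthogonal_matrix_def transpose_monomial monomial_mult mat_1_monomial signs_def
    intro!: arg_cong[of _ _ "\<lambda>s. monomial s 0"]) (metis mult_1 square_eq_1_iff)+

lemma signs_simps [simp]: "(\<lambda>_. 1) \<in> signs" "axis_signs i \<in> signs"
  by (simp_all add: signs_def axis_signs_def)

lemma signs_mult: "s \<in> signs \<Longrightarrow> t \<in> signs \<Longrightarrow> (\<lambda>i. s i * t (i + k)) \<in> signs"
proof -
  assume "s \<in> signs" "t \<in> signs"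
  then have "s i = 1 \<or> s i = - 1" "t i = 1 \<or> t i = - 1" for i
    by (auto simp: signs_def)
  then have "s i * t (i + k) = 1 \<or> s i * t (i + k) = - 1" for i
    by (metis mult_1 mult_minus1 minus_minus)
  then show ?thesis
    by (simp add: signs_def)
qed

lemma subgroup_monomial: "subgroup {monomial s k | s k. s \<in> signs} O3"
proof (rule O3.subgroupI)
  show "{monomial s k | s k. s \<in> signs} \<noteq> {}"
    using signs_simps by blast
next
  fix A B assume "A \<in> {monomial s k | s k. s \<in> signs}" "B \<in> {monomial s k | s k. s \<in> signs}"
  then show "A \<otimes>\<^bsub>O3\<^esub> B \<in> {monomial s k | s k. s \<in> signs}"
    by (auto simp: monomial_mult) (use signs_mult in blast)
qed (auto simp: orthogonal_monomial inv_O3 transpose_monomial, auto simp: signs_def)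

text \<open>The generators of \<open>T_grp\<close> are signed cyclic permutation matrices, and these are
  closed under products, inverses and negation. Conversely a signed cyclic permutation matrix
  factors into a diagonal sign matrix, which is \<open>\<plusminus> 1\<close> times the identity
  or a half-turn about a coordinate axis, and a power of the rotation about the diagonal of the
  cube.\<close>
lemma oplus_Z2c_T: "oplus_Z2c T_grp = {monomial s k | s k. s \<in> signs}" (is "_ = ?M")
proof
  have "T_grp \<subseteq> ?M"
    unfolding T_grp_def
    by (rule O3.generate_subgroup_incl[OF _ subgroup_monomial])
      (use signs_simps in \<open>auto simp: rotation_e1_half_turn rotation_e3_half_turn
        rotation_diagonal_monomial half_turn_def simp del: signs_simps\<close>)
  then show "oplus_Z2c T_grp \<subseteq> ?M"
    unfolding oplus_Z2c_def by (fastforce simp: uminus_monomial signs_def)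
next
  interpret T: subgroup T_grp O3 by (rule subgroup_T)
  have mult: "A ** B \<in> T_grp" if "A \<in> T_grp" "B \<in> T_grp" for A B
    using T.m_closed[OF that] by simp
  have h3: "half_turn 3 \<in> T_grp" and h1: "half_turn 1 \<in> T_grp" and P: "monomial (\<lambda>_. 1) 2 \<in> T_grp"
    unfolding T_grp_def
    by (auto simp: rotation_e1_half_turn rotation_e3_half_turn rotation_diagonal_monomial
        intro!: generate.incl)
  have h: "half_turn i \<in> T_grp" for i
  proof -
    have "half_turn 1 ** half_turn 3 = half_turn 2"
      using arg_cong[of "- 1 - 3" 2 half_turn] by (simp add: half_turn_mult del: minus_diff_eq)
    then show ?thesis
      using mult[OF h1 h3] h1 h3 exhaust_3[of i] by auto
  qed
  have one: "mat 1 \<in> T_grp" using T.one_closed by simp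
  have P: "monomial (\<lambda>_. 1) k \<in> T_grp" for k
  proof -
    have "monomial (\<lambda>_. 1) 2 ** monomial (\<lambda>_. 1) 2 = monomial (\<lambda>_. 1) 1"
      using arg_cong[of "2 + 2" 1 "monomial (\<lambda>_. 1)"] by (simp add: monomial_mult)
    moreover have "monomial (\<lambda>_. 1) 3 = mat 1"
      using arg_cong[of 3 0 "monomial (\<lambda>_. 1)"] by (simp add: mat_1_monomial)
    ultimately show ?thesis
      using mult[OF P P] P one exhaust_3[of k] by auto
  qed
  show "?M \<subseteq> oplus_Z2c T_grp"
  proof safe
    fix s k assume s: "s \<in> signs"
    have e: "monomial s k = monomial s 0 ** monomial (\<lambda>_. 1) k"
      by (simp add: monomial_mult)
    from s show "monomial s k \<in> oplus_Z2c T_grp" unfolding e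
      by (cases rule: diagonal_cases) (use P h mult in \<open>auto simp: oplus_Z2c_def\<close>)
  qed
qed

lemma half_turn_in_O3: "orthogonal_matrix (half_turn i)"
  by (simp add: half_turn_def orthogonal_monomial)

lemma trace_monomial: "k \<noteq> 0 \<Longrightarrow> trace (monomial s k) = 0"
  by (simp add: trace_def monomial_def)

text \<open>The membership in \<open>oplus_Z2c_T\<close> gives some representation with signs; the position
  of the nonzero entries makes that representation unique.\<close>
lemma monomial_in_oplus:
  assumes "monomial s k \<in> oplus_Z2c T_grp"
  shows "s \<in> signs"
proof -
  obtain t l where t: "t \<in> signs" and eq: "monomial s k = monomial t l"
    using assms by (auto simp: oplus_Z2c_T)
  have "s i = t i" for i
  proof -
    have "monomial s k $ i $ (i + l) = t i" unfolding eq by (simp add: monomial_def)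
    moreover have "t i \<noteq> 0" using t by (auto simp: signs_def dest: spec[of _ i])
    ultimately show ?thesis by (auto simp: monomial_def split: if_splits)
  qed
  then have "s = t" by auto
  then show ?thesis using t by simp
qed

lemma half_turn_in_oplus:
  "half_turn i \<in> oplus_Z2c T_grp" "- half_turn i \<in> oplus_Z2c T_grp"
proof -
  have "(\<lambda>j. - axis_signs i j) \<in> signs"
    by (auto simp: signs_def axis_signs_def)
  then show "half_turn i \<in> oplus_Z2c T_grp" "- half_turn i \<in> oplus_Z2c T_grp"
    unfolding oplus_Z2c_T half_turn_def uminus_monomial using signs_simps(2) by blast+
qed

lemma third_index: "- 1 - 3 = (2 :: 3)" "- 3 - 1 = (2 :: 3)" "(1 :: 3) \<noteq> 3" "(3 :: 3) \<noteq> 1"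
  by simp_all

section \<open>Elements of the dihedral-type groups\<close>

text \<open>For \<open>b\<close> false this is the rotation by \<open>a\<close> about \<open>e3\<close>; for
  \<open>b\<close> true it is that rotation after the half-turn about \<open>e1\<close>, that is,
  the half-turn about the horizontal axis at angle \<open>a / 2\<close>.\<close>
definition dihedral :: "real \<Rightarrow> bool \<Rightarrow> mat3" where
  "dihedral a b = vector [vector [cos a, if b then sin a else - sin a, 0],
     vector [sin a, if b then - cos a else cos a, 0], vector [0, 0, if b then - 1 else 1]]"

lemma rotation_e3_dihedral: "rotation e3 a = dihedral a False"
  by (simp add: dihedral_def rotation_e3)

lemma rotation_e1_dihedral: "rotation e1 pi = dihedral 0 True"
  by (simp add: dihedral_def rotation_e1_pi)

lemma mat_1_dihedral: "mat 1 = dihedral 0 False"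
  by (simp add: dihedral_def mat_def vec_eq_iff forall_3)

lemma dihedral_mult:
  "dihedral a b ** dihedral c d = dihedral (if b then a - c else a + c) (b \<noteq> d)"
  by (cases b; cases d)
    (simp_all add: dihedral_def vec_eq_iff forall_3 matrix_matrix_mult_def sum_3
      cos_add sin_add cos_diff sin_diff)

lemma transpose_dihedral: "transpose (dihedral a b) = dihedral (if b then a else - a) b"
  by (simp add: dihedral_def transpose_def vec_eq_iff forall_3)

lemma trace_dihedral: "trace (dihedral a b) = (if b then - 1 else 1 + 2 * cos a)"
  by (simp add: dihedral_def trace_def sum_3)

lemma dihedral_mult_e3: "dihedral a b *v e3 = (if b then - e3 else e3)"
  unfolding dihedral_def
  by (simp add: matrix_vector_mult_def sum_3 vec_eq_iff forall_3 axis_def)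

lemma det_dihedral: "det (dihedral a b) = 1"
  by (simp add: dihedral_def det_3 power2_eq_square[symmetric])

lemma half_turn_1_dihedral: "half_turn 1 = dihedral 0 True"
  and half_turn_3_dihedral: "half_turn 3 = dihedral pi False"
  and half_turn_2_dihedral: "half_turn 2 = dihedral pi True"
proof -
  show 1: "half_turn 1 = dihedral 0 True"
    using rotation_e1_half_turn rotation_e1_dihedral by simp
  show 3: "half_turn 3 = dihedral pi False"
    using rotation_e3_half_turn rotation_e3_dihedral by simp
  have "half_turn 2 = half_turn 3 ** half_turn 1"
    using arg_cong[of "- 3 - 1" 2 half_turn] by (simp add: half_turn_mult del: minus_diff_eq)
  then show "half_turn 2 = dihedral pi True"
    by (simp add: 1 3 dihedral_mult)
qed

lemma dihedral_periodic: "dihedral (a + 2 * of_int l * pi) b = dihedral a b"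
proof -
  have "cos (a + 2 * of_int l * pi) = cos a" "sin (a + 2 * of_int l * pi) = sin a"
    using sin_cos_eq_iff[of "a + 2 * of_int l * pi" a] by (auto simp: mult.commute)
  then show ?thesis
    by (simp add: dihedral_def)
qed

lemma half_turn_det: "det (half_turn i) = 1"
proof -
  have "half_turn i = dihedral 0 True \<or> half_turn i = dihedral pi True \<or> half_turn i = dihedral pi False"
    using exhaust_3[of i] half_turn_1_dihedral half_turn_2_dihedral half_turn_3_dihedral by auto
  then show ?thesis
    using det_dihedral by auto
qed

lemma half_turn_trace: "trace (half_turn i) = - 1"
proof -
  have "half_turn i = dihedral 0 True \<or> half_turn i = dihedral pi True \<or> half_turn i = dihedral pi False"
    using exhaust_3[of i] half_turn_1_dihedral half_turn_2_dihedral half_turn_3_dihedral by auto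
  then show ?thesis
    by (auto simp: trace_dihedral)
qed

text \<open>The integer \<open>j\<close> ranges over all of \<open>\<int>\<close> and so repeats elements;
  in exchange, closure under products needs no reduction modulo \<open>k\<close>.\<close>
lemma D_grp_dihedral:
  assumes "k \<ge> 2"
  shows "D_grp k = {dihedral (2 * of_int j * pi / k) b | j b. True}" (is "_ = ?D")
proof -
  let ?G = "{rotation e3 (2 * pi / k), rotation e1 pi}"
  have eq: "D_grp k = generate O3 ?G"
    using assms by (simp add: D_grp_def)
  have mult: "A ** B \<in> ?D" if AB: "A \<in> ?D" "B \<in> ?D" for A B
  proof -
    obtain i b j c where *: "A = dihedral (2 * of_int i * pi / k) b" "B = dihedral (2 * of_int j * pi / k) c"
      using AB by blast
    have "A ** B = dihedral (2 * of_int (if b then i - j else i + j) * pi / k) (b \<noteq> c)"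
      by (simp add: * dihedral_mult ring_distribs diff_divide_distrib add_divide_distrib)
    then show ?thesis by blast
  qed
  have gens: "rotation e3 (2 * pi / k) = dihedral (2 * of_int 1 * pi / k) False"
    "rotation e1 pi = dihedral (2 * of_int 0 * pi / k) True"
    "mat 1 = dihedral (2 * of_int 0 * pi / k) False"
    by (simp_all add: rotation_e3_dihedral rotation_e1_dihedral mat_1_dihedral)
  have invs: "transpose (rotation e3 (2 * pi / k)) = dihedral (2 * of_int (-1) * pi / k) False"
    "transpose (rotation e1 pi) = dihedral (2 * of_int 0 * pi / k) True"
    by (simp_all add: rotation_e3_dihedral rotation_e1_dihedral transpose_dihedral)
  have "A \<in> ?D" if "A \<in> generate O3 ?G" for A
    using that
  proof induction
    case one
    then show ?case unfolding one_O3 gens by blast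
  next
    case (incl h)
    then show ?case using gens(1,2) by blast
  next
    case (inv h)
    have "orthogonal_matrix h"
      using inv rotation_in_O3[of e1 pi] rotation_in_O3[of e3 "2 * pi / k"] by (auto simp: axis_eq_0_iff)
    then have "inv\<^bsub>O3\<^esub> h = transpose h"
      by (rule inv_O3)
    then have "inv\<^bsub>O3\<^esub> h \<in> {dihedral (2 * of_int (-1) * pi / k) False, dihedral (2 * of_int 0 * pi / k) True}"
      using inv unfolding invs[symmetric] by blast
    then show ?case by blast
  next
    case (eng h1 h2)
    then show ?case using mult by simp
  qed
  moreover have "dihedral (2 * of_int j * pi / k) b \<in> generate O3 ?G" for j b
  proof -
    interpret G: subgroup "generate O3 ?G" O3
      using O3.generate_is_subgroup[of ?G] rotation_in_O3[of e1 pi] rotation_in_O3[of e3 "2 * pi / k"]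
      by (auto simp: axis_eq_0_iff)
    have closed: "A ** B \<in> generate O3 ?G" if "A \<in> generate O3 ?G" "B \<in> generate O3 ?G" for A B
      using G.m_closed[OF that] by simp
    have r: "dihedral (2 * pi / k) False \<in> generate O3 ?G" and f: "dihedral 0 True \<in> generate O3 ?G"
      using generate.incl[of _ ?G O3] by (auto simp: rotation_e1_dihedral rotation_e3_dihedral)
    have r': "dihedral (- (2 * pi / k)) False \<in> generate O3 ?G"
      using G.m_inv_closed[OF r] rotation_in_O3[of e3 "2 * pi / k"]
      by (simp add: inv_O3 rotation_e3_dihedral transpose_dihedral axis_eq_0_iff)
    have "dihedral (2 * of_int j * pi / k) False \<in> generate O3 ?G" for j
    proof (induction j rule: int_induct[of _ 0])
      case base
      then show ?case using G.one_closed by (simp add: mat_1_dihedral)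
    next
      case (step1 j)
      then show ?case using closed[OF step1(2) r]
        by (simp add: dihedral_mult ring_distribs add_divide_distrib)
    next
      case (step2 j)
      then show ?case using closed[OF step2(2) r']
        by (simp add: dihedral_mult ring_distribs diff_divide_distrib)
    qed
    note rot = this[of j]
    show ?thesis
      using rot closed[OF rot f] by (cases b) (simp_all add: dihedral_mult)
  qed
  ultimately show ?thesis
    unfolding eq by blast
qed

text \<open>Even \<open>m\<close> gives the rotation part \<open>D_grp n\<close> and odd \<open>m\<close>
  the coset of \<open>- r(e3, \<pi>/n)\<close>: up to the factor \<open>dihedral 0 b\<close>, the
  element with index \<open>m\<close> is the \<open>m\<close>-th power of \<open>- r(e3,
  \<pi>/n)\<close>. The single index makes the parity of \<open>m\<close> carry the determinant.\<close>
lemma D_d_grp_dihedral: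
  assumes "n \<ge> 2"
  shows "D_d_grp n = {(- 1) powi m *\<^sub>R dihedral (of_int m * pi / n) b | m b. True}" (is "_ = ?R")
proof
  have odd: "(- rotation e3 (pi / n)) ** dihedral (2 * of_int j * pi / n) b
      = (- 1) powi (2 * j + 1) *\<^sub>R dihedral (of_int (2 * j + 1) * pi / n) b" for j b
  proof -
    have "rotation e3 (pi / n) = dihedral (pi / n) False"
      by (rule rotation_e3_dihedral)
    then show ?thesis
      by (simp add: dihedral_mult power_int_add power_int_mult ring_distribs add_divide_distrib add.commute)
  qed
  have even: "dihedral (2 * of_int j * pi / n) b = (- 1) powi (2 * j) *\<^sub>R dihedral (of_int (2 * j) * pi / n) b"
    for j b
    by (simp add: power_int_mult)
  show "D_d_grp n \<subseteq> ?R"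
  proof
    fix A assume "A \<in> D_d_grp n"
    then obtain j b where "A = dihedral (2 * of_int j * pi / n) b
        \<or> A = (- rotation e3 (pi / n)) ** dihedral (2 * of_int j * pi / n) b"
      unfolding D_d_grp_def D_grp_dihedral[OF assms] l_coset_def mult_O3 by blast
    then show "A \<in> ?R"
      unfolding odd unfolding even by blast
  qed
  show "?R \<subseteq> D_d_grp n"
  proof safe
    fix m b
    show "(- 1) powi m *\<^sub>R dihedral (of_int m * pi / n) b \<in> D_d_grp n"
    proof (cases "even m")
      case True
      then obtain j where "m = 2 * j" ..
      then show ?thesis
        unfolding D_d_grp_def D_grp_dihedral[OF assms] using even[of j b, symmetric] by blast
    next
      case False
      then obtain j where "m = 2 * j + 1" by (rule oddE)
      then show ?thesis
        unfolding D_d_grp_def D_grp_dihedral[OF assms] l_coset_def mult_O3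
        using odd[of j b, symmetric] by blast
    qed
  qed
qed

lemma D_d_grp_mult:
  assumes n: "n \<ge> 2" and AB: "A \<in> D_d_grp n" "B \<in> D_d_grp n"
  shows "A ** B \<in> D_d_grp n"
proof -
  obtain i b j c where A: "A = (- 1) powi i *\<^sub>R dihedral (of_int i * pi / n) b"
    and B: "B = (- 1) powi j *\<^sub>R dihedral (of_int j * pi / n) c"
    using AB unfolding D_d_grp_dihedral[OF n] by blast
  have "A ** B = ((- 1) powi i * (- 1) powi j) *\<^sub>R
      (dihedral (of_int i * pi / n) b ** dihedral (of_int j * pi / n) c)"
    unfolding A B by (simp add: matrix_scalar_ac scalar_matrix_assoc[symmetric])
  also have "(- 1) powi i * (- 1) powi j = ((- 1) powi (if b then i - j else i + j) :: real)"
    by (simp add: power_int_minus_left)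
  also have "dihedral (of_int i * pi / n) b ** dihedral (of_int j * pi / n) c
      = dihedral (of_int (if b then i - j else i + j) * pi / n) (b \<noteq> c)"
    by (simp add: dihedral_mult ring_distribs add_divide_distrib diff_divide_distrib)
  finally show ?thesis
    unfolding D_d_grp_dihedral[OF n] by blast
qed

lemma D_d_grp_mult_e3: "n \<ge> 2 \<Longrightarrow> A \<in> D_d_grp n \<Longrightarrow> A *v e3 = e3 \<or> A *v e3 = - e3"
  by (auto simp: D_d_grp_dihedral dihedral_mult_e3 scaleR_matrix_vector_assoc[symmetric] power_int_minus_left)

text \<open>An element of trace \<open>- 3\<close> would need an odd \<open>m\<close> for which \<open>m
  \<pi> / n\<close> is a multiple of \<open>2 \<pi>\<close>, and then \<open>m = 2 l n\<close>
  would be even.\<close>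
lemma minus_one_notin_D_d_grp:
  assumes n: "n \<ge> 2"
  shows "- mat 1 \<notin> D_d_grp n"
proof
  assume "- mat 1 \<in> D_d_grp n"
  then obtain m b where m: "- mat 1 = (- 1) powi m *\<^sub>R dihedral (of_int m * pi / n) b"
    unfolding D_d_grp_dihedral[OF n] by blast
  have "(- 1) powi m * (if b then - 1 else 1 + 2 * cos (of_int m * pi / n)) = (- 3 :: real)"
    using arg_cong[OF m, of trace] trace_scaleR[of "- 1" "mat 1"]
    by (simp add: trace_scaleR trace_dihedral trace_I)
  moreover have "cos (of_int m * pi / n) \<ge> - 1" "cos (of_int m * pi / n) \<le> 1"
    by simp_all
  ultimately have "odd m \<and> cos (of_int m * pi / n) = 1"
    by (cases b; cases "even m") (simp_all add: power_int_minus_left)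
  then have "odd m" "cos (of_int m * pi / n) = cos 0"
    by simp_all
  then obtain l :: int where "of_int m * pi / n = 2 * of_int l * pi"
    unfolding cos_eq by (auto elim!: Ints_cases)
  then have "real_of_int m = real_of_int (2 * l * int n)"
    using n by (simp add: field_simps)
  then have "m = 2 * l * int n"
    by (simp only: of_int_eq_iff)
  then show False
    using \<open>odd m\<close> by simp
qed

text \<open>Trace \<open>0\<close> forces a rotation part with cosine \<open>- 1 / 2\<close>, that is
  \<open>3 m = 2 n (3 l \<plusminus> 1)\<close>. Hence \<open>m\<close> is even, which excludes
  the rotoinversions, and \<open>3\<close> divides \<open>n\<close>.\<close>
lemma D_d_grp_trace_0:
  assumes n: "n \<ge> 2" and A: "A \<in> D_d_grp n" "trace A = 0"
  obtains "3 dvd n" "A = dihedral (2 * pi / 3) False"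
  | "3 dvd n" "A = dihedral (- (2 * pi / 3)) False"
proof -
  obtain m b where m: "A = (- 1) powi m *\<^sub>R dihedral (of_int m * pi / n) b"
    using A unfolding D_d_grp_dihedral[OF n] by blast
  have "(if b then - 1 else 1 + 2 * cos (of_int m * pi / n)) = (0::real)"
    using A(2) by (simp add: m trace_scaleR trace_dihedral)
  then have b: "\<not> b" and "cos (of_int m * pi / n) = - 1 / 2"
    by (cases b; simp)+
  then have "cos (of_int m * pi / n) = cos (2 * pi / 3)"
    using cos_120 by (simp add: mult.commute)
  then obtain l :: int where "of_int m * pi / n = 2 * pi / 3 + 2 * of_int l * pi
      \<or> of_int m * pi / n = - (2 * pi / 3) + 2 * of_int l * pi"
    unfolding cos_eq by (auto elim!: Ints_cases)
  then obtain s :: int where s: "s = 1 \<or> s = - 1"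
    and l: "of_int m * pi / n = of_int s * (2 * pi / 3) + 2 * of_int l * pi"
  proof
    assume "of_int m * pi / n = 2 * pi / 3 + 2 * of_int l * pi"
    then show thesis using that[of 1] by simp
  next
    assume "of_int m * pi / n = - (2 * pi / 3) + 2 * of_int l * pi"
    then show thesis using that[of "- 1"] by simp
  qed
  then have "of_int (3 * m) * pi = of_int (2 * int n * (s + 3 * l)) * pi"
    using n by (simp add: field_simps)
  then have eq: "3 * m = 2 * int n * (s + 3 * l)"
    by (simp flip: of_int_mult of_int_add)
  \<comment> \<open>Modulo 3 the equation reads \<open>2 n s = 0\<close>, and \<open>s * s = 1\<close>.\<close>
  have "3 dvd int n"
  proof -
    have "2 * int n = 3 * (s * (m - 2 * int n * l))"
      using s eq by (auto simp: algebra_simps)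
    then have "3 dvd 2 * int n"
      by (metis dvd_triv_left)
    then show ?thesis by presburger
  qed
  then have 3: "3 dvd n" by presburger
  have "even (3 * m)" unfolding eq by simp
  then have "(- 1) powi m = (1::real)" by (simp add: power_int_minus_left)
  then have "A = dihedral (of_int s * (2 * pi / 3)) False"
    using b unfolding m l dihedral_periodic by simp
  with s 3 that show thesis by auto
qed

section \<open>The listed groups as explicit sets\<close>

lemma Z_grp_image: "Z_grp k = (\<lambda>j. dihedral (2 * real j * pi / real k) False) ` {..<k}"
  by (auto simp: Z_grp_def rotation_e3_dihedral)

lemma Z_grp_3:
  "Z_grp 3 = {mat 1, dihedral (2 * pi / 3) False, dihedral (- (2 * pi / 3)) False}"
proof -
  have "{..<3} = {0, 1, 2 :: nat}"
    by auto
  then have "Z_grp 3 = (\<lambda>j. dihedral (2 * real j * pi / 3) False) ` {0, 1, 2}"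
    by (simp add: Z_grp_image)
  moreover have "dihedral (4 * pi / 3) False = dihedral (- (2 * pi / 3)) False"
    using dihedral_periodic[of "- (2 * pi / 3)" 1 False] by (simp add: field_simps)
  ultimately show ?thesis
    by (simp add: mat_1_dihedral)
qed

lemma Z_grp_1: "Z_grp 1 = {mat 1}"
  by (simp add: Z_grp_def rotation_e3_dihedral mat_1_dihedral)

lemma Z_grp_2: "Z_grp 2 = {mat 1, half_turn 3}"
proof -
  have "{..<2} = {0, 1 :: nat}"
    by auto
  then have "Z_grp 2 = (\<lambda>j. dihedral (2 * real j * pi / 2) False) ` {0, 1}"
    by (simp add: Z_grp_image)
  then show ?thesis
    by (simp add: mat_1_dihedral half_turn_3_dihedral)
qed

lemma D_grp_1: "D_grp 1 = Z_grp 2"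
  by (simp add: D_grp_def)

text \<open>The rotations of angle \<open>j \<pi>\<close> depend only on the parity of \<open>j\<close>.\<close>
lemma D_grp_2: "D_grp 2 = insert (mat 1) (range half_turn)"
proof -
  have r: "range half_turn = {half_turn 1, half_turn 2, half_turn 3}"
    by (simp add: UNIV_3)
  have "dihedral (2 * of_int j * pi / 2) b = (if even j then dihedral 0 b else dihedral pi b)" for j b
  proof (cases "even j")
    case True
    then obtain l where "j = 2 * l" ..
    then have "2 * of_int j * pi / 2 = 0 + 2 * of_int l * pi"
      by simp
    then show ?thesis
      using dihedral_periodic[of 0 l b] \<open>even j\<close> by (simp only: if_True)
  next
    case False
    then obtain l where "j = 2 * l + 1" by (rule oddE)
    then have "2 * of_int j * pi / 2 = pi + 2 * of_int l * pi"
      by (simp add: algebra_simps)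
    then show ?thesis
      using dihedral_periodic[of pi l b] \<open>odd j\<close> by (simp only: if_False)
  qed
  note f = this
  have "D_grp 2 = {dihedral 0 False, dihedral 0 True, dihedral pi False, dihedral pi True}"
  proof (intro equalityI subsetI)
    fix A assume "A \<in> D_grp 2"
    then obtain j :: int and b where "A = dihedral (2 * of_int j * pi / 2) b"
      unfolding D_grp_dihedral[OF order.refl] of_nat_numeral by blast
    then show "A \<in> {dihedral 0 False, dihedral 0 True, dihedral pi False, dihedral pi True}"
      unfolding f by (cases b; cases "even j") simp_all
  next
    have "dihedral (2 * of_int j * pi / 2) b \<in> D_grp 2" for j :: int and b
      unfolding D_grp_dihedral[OF order.refl] of_nat_numeral by blast
    from this[of 0] this[of 1] have "dihedral 0 b \<in> D_grp 2" "dihedral pi b \<in> D_grp 2" for b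
      by simp_all
    then show "A \<in> D_grp 2"
      if "A \<in> {dihedral 0 False, dihedral 0 True, dihedral pi False, dihedral pi True}" for A
      using that by auto
  qed
  then show ?thesis
    unfolding r mat_1_dihedral half_turn_1_dihedral half_turn_2_dihedral half_turn_3_dihedral by auto
qed

lemma D2_z_half_turn: "D2_z = insert (mat 1) (insert (half_turn 3) {- half_turn j | j. j \<noteq> 3})"
proof -
  have "half_turn 1 ** half_turn 3 = half_turn 2"
    using arg_cong[of "- 1 - 3" 2 half_turn] by (simp add: half_turn_mult del: minus_diff_eq)
  then have "D2_z = {mat 1, half_turn 3, - half_turn 1, - half_turn 2}"
    by (auto simp: D2_z_def Z_grp_2 l_coset_def rotation_e1_half_turn)
  moreover have "{- half_turn j | j. j \<noteq> 3} = {- half_turn 1, - half_turn 2}"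
    using exhaust_3 by force
  ultimately show ?thesis
    by auto
qed

section \<open>Intersections seen from the tetrahedral frame\<close>

text \<open>The intersection of \<open>D_d_grp n\<close> with the conjugate by \<open>g\<close>, conjugated
  back by \<open>g\<close>. It has the same class as the intersection and is a set of signed
  cyclic permutation matrices.\<close>
definition pullback :: "nat \<Rightarrow> mat3 \<Rightarrow> mat3 set" where
  "pullback n g = {A \<in> oplus_Z2c T_grp. g ** A ** transpose g \<in> D_d_grp n}"

lemma conj_by_pullback:
  assumes "orthogonal_matrix g"
  shows "conj_by g (pullback n g) = D_d_grp n \<inter> conj_by g (oplus_Z2c T_grp)"
  unfolding conj_by_image[OF assms] pullback_def by auto

lemma pullback_subset_O3: "pullback n g \<subseteq> carrier O3"
  using oplus_Z2c_T_subset_O3 by (auto simp: pullback_def)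

lemma clips_pullback:
  "conj_class (D_d_grp n) \<circledcirc> conj_class (oplus_Z2c T_grp)
     = {conj_class (pullback n g) | g. orthogonal_matrix g}"
proof -
  have "conj_class (D_d_grp n \<inter> conj_by g (oplus_Z2c T_grp)) = conj_class (pullback n g)"
    if "orthogonal_matrix g" for g
    using that by (simp add: conj_by_pullback[symmetric] conj_class_conj_by pullback_subset_O3)
  then show ?thesis
    unfolding clips_conj_class[OF D_d_subset_O3 oplus_Z2c_T_subset_O3] carrier_O3
    by (intro Collect_cong iff_exI) auto
qed

lemma pullback_monomial:
  assumes "A \<in> pullback n g"
  obtains s k where "s \<in> signs" "A = monomial s k"
  using assms by (auto simp: pullback_def oplus_Z2c_T)

lemma pullback_mult:
  assumes "n \<ge> 2" "orthogonal_matrix g" "A \<in> pullback n g" "B \<in> pullback n g"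
  shows "A ** B \<in> pullback n g"
proof -
  have "A ** B \<in> oplus_Z2c T_grp"
    using assms(3,4) subgroup.m_closed[OF subgroup_monomial, of A B]
    by (simp add: pullback_def oplus_Z2c_T)
  then show ?thesis
    using assms D_d_grp_mult[of n "g ** A ** transpose g" "g ** B ** transpose g"]
    by (simp add: pullback_def mult_conj)
qed

lemma pullback_one:
  assumes "n \<ge> 2" "orthogonal_matrix g"
  shows "mat 1 \<in> pullback n g"
proof -
  have "mat 1 \<in> D_d_grp n"
    unfolding D_d_grp_dihedral[OF assms(1)] mat_1_dihedral
    by (rule CollectI, rule exI[of _ 0]) auto
  moreover have "mat 1 \<in> oplus_Z2c T_grp"
    using subgroup.one_closed[OF subgroup_monomial] by (simp add: oplus_Z2c_T)
  ultimately show ?thesis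
    using assms(2) by (simp add: pullback_def orthogonal_matrix_def)
qed

lemma minus_one_notin_pullback:
  "n \<ge> 2 \<Longrightarrow> orthogonal_matrix g \<Longrightarrow> - mat 1 \<notin> pullback n g"
  using minus_one_notin_D_d_grp by (auto simp: pullback_def orthogonal_matrix_def)

section \<open>Intersections with an element of order three\<close>

text \<open>Let \<open>X\<close> be the conjugate of the given element. By its trace it is a rotation by
  \<open>\<plusminus> 2\<pi>/3\<close> about \<open>e3\<close>. An element \<open>B\<close> with
  trivial cyclic part becomes, multiplied by the given element, one with nontrivial cyclic part,
  so that \<open>X\<close> times the conjugate of \<open>B\<close> is again such a rotation. Hence
  the conjugate of \<open>B\<close> is in \<open>Z_grp 3\<close> as well, without any discussion
  of how the axes of the cube lie.\<close>
lemma pullback_order_3: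
  assumes n: "n \<ge> 2" and g: "orthogonal_matrix g"
    and A: "monomial s k \<in> pullback n g" and k: "k \<noteq> 0"
  shows "3 dvd n" and "conj_class (pullback n g) = conj_class (Z_grp 3)"
proof -
  let ?r = "\<lambda>c. dihedral (c * (2 * pi / 3)) False"
  have Z: "Z_grp 3 = {?r 0, ?r 1, ?r (- 1)}"
    by (simp add: Z_grp_3 mat_1_dihedral)
  \<comment> \<open>\<open>?r c\<close> depends only on \<open>c\<close> modulo 3.\<close>
  have r2: "?r 2 = ?r (- 1)" and r2': "?r (- 2) = ?r 1"
    using dihedral_periodic[of "- (2 * pi / 3)" 1 False] dihedral_periodic[of "2 * pi / 3" "- 1" False]
    by (simp_all add: field_simps)
  have r_mult: "?r c ** ?r d = ?r (c + d)" for c d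
    by (simp add: dihedral_mult ring_distribs add_divide_distrib)
  have off: "3 dvd n \<and> (g ** monomial t l ** transpose g = ?r 1 \<or> g ** monomial t l ** transpose g = ?r (- 1))"
    if "monomial t l \<in> pullback n g" "l \<noteq> 0" for t l
  proof -
    have "trace (g ** monomial t l ** transpose g) = 0"
      using that g by (simp add: trace_conj trace_monomial)
    moreover have "g ** monomial t l ** transpose g \<in> D_d_grp n"
      using that by (simp add: pullback_def)
    ultimately show ?thesis
      using D_d_grp_trace_0[OF n] by (metis mult_1 mult_minus1)
  qed
  show "3 dvd n"
    using off[OF A k] by simp
  define X where "X = g ** monomial s k ** transpose g"
  obtain c where c: "c = 1 \<or> c = - 1" and X: "X = ?r c"
    using off[OF A k] unfolding X_def by blast
  have in_Z: "g ** B ** transpose g \<in> Z_grp 3" if B: "B \<in> pullback n g" for B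
  proof -
    obtain t l where Btl: "B = monomial t l"
      using B by (rule pullback_monomial)
    show ?thesis
    proof (cases "l = 0")
      case False
      then show ?thesis using off[of t l] B by (auto simp: Z Btl)
    next
      case True
      let ?Y = "g ** B ** transpose g"
      have AB: "monomial s k ** B = monomial (\<lambda>i. s i * t (i + k)) k"
        by (simp add: Btl True monomial_mult)
      have "X ** ?Y = ?r 1 \<or> X ** ?Y = ?r (- 1)"
        unfolding X_def mult_conj[OF g] AB
        using off[of _ k] k pullback_mult[OF n g A B] by (simp add: AB)
      then obtain d where d: "d = 1 \<or> d = - 1" and XY: "X ** ?Y = ?r d"
        by blast
      have "?r (- c) ** X = mat 1"
        unfolding X r_mult by (simp add: mat_1_dihedral)
      then have "?Y = ?r (- c) ** (X ** ?Y)"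
        by (simp only: matrix_mul_assoc matrix_mul_lid)
      then have Y: "?Y = ?r (- c + d)"
        unfolding XY r_mult .
      have "- c + d = 0 \<or> - c + d = 2 \<or> - c + d = - 2"
        using c d by auto
      then show ?thesis
        unfolding Y Z by (elim disjE) (simp_all only: r2 r2' insert_iff simp_thms)
    qed
  qed
  have "Z_grp 3 \<subseteq> conj_by g (pullback n g)"
  proof -
    have "Z_grp 3 = {mat 1, X, X ** X}"
    proof -
      have XX: "X ** X = ?r (c + c)"
        unfolding X r_mult ..
      have "(c = 1 \<and> c + c = 2) \<or> (c = - 1 \<and> c + c = - 2)"
        using c by auto
      moreover have "mat 1 = ?r 0"
        by (simp add: mat_1_dihedral)
      ultimately show ?thesis
        unfolding Z XX unfolding X
        by (elim disjE conjE) (simp_all only: r2 r2' insert_commute)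
    qed
    moreover have "mat 1 = g ** mat 1 ** transpose g"
      using g by (simp add: orthogonal_matrix_def)
    moreover have "X ** X = g ** (monomial s k ** monomial s k) ** transpose g"
      unfolding X_def mult_conj[OF g] ..
    moreover have "g ** B ** transpose g \<in> conj_by g (pullback n g)" if "B \<in> pullback n g" for B
      using that by (simp add: conj_by_image[OF g])
    note this[OF pullback_one[OF n g]] this[OF A] this[OF pullback_mult[OF n g A A]]
    ultimately show ?thesis
      unfolding X_def by (simp only: insert_subset empty_subsetI simp_thms)
  qed
  then have "conj_by g (pullback n g) = Z_grp 3"
    using in_Z unfolding conj_by_image[OF g] by blast
  then show "conj_class (pullback n g) = conj_class (Z_grp 3)"
    using conj_class_conj_by[of g "pullback n g"] g pullback_subset_O3 by simp
qed

lemma orthogonal_uminus: "orthogonal_matrix (- A :: mat3) \<longleftrightarrow> orthogonal_matrix A"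
  using uminus_in_O3[of A] uminus_in_O3[of "- A"] by auto

section \<open>Conjugacy classes of groups of diagonal sign matrices\<close>

text \<open>Conjugation by a cyclic permutation matrix permutes the coordinate axes, so that the groups
  below depend on the chosen axis only up to conjugacy.\<close>
lemma conj_class_shift:
  assumes "K \<subseteq> carrier O3"
  shows "conj_class ((\<lambda>A. monomial (\<lambda>_. 1) k ** A ** transpose (monomial (\<lambda>_. 1) k)) ` K) = conj_class K"
proof -
  have g: "orthogonal_matrix (monomial (\<lambda>_. 1) k)"
    by (simp add: orthogonal_monomial)
  show ?thesis
    using conj_class_conj_by[of "monomial (\<lambda>_. 1) k" K] g assms by (simp add: conj_by_image[OF g])
qed

lemma shift_half_turn:
  "monomial (\<lambda>_. 1) k ** half_turn i ** transpose (monomial (\<lambda>_. 1) k) = half_turn (i - k)"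
proof -
  have "(\<lambda>j. axis_signs i (j + k)) = axis_signs (i - k)"
    by (simp add: axis_signs_def fun_eq_iff eq_diff_eq)
  then show ?thesis
    by (simp add: half_turn_def transpose_monomial monomial_mult)
qed

lemma shift_one: "monomial (\<lambda>_. 1) k ** transpose (monomial (\<lambda>_. 1) k) = mat 1"
  by (simp add: transpose_monomial monomial_mult mat_1_monomial)

lemma conj_class_half_turn: "conj_class {mat 1, half_turn i} = conj_class (Z_grp 2)"
  using conj_class_shift[of "{mat 1, half_turn i}" "i - 3"]
  by (simp add: Z_grp_2 shift_half_turn shift_one half_turn_in_O3 orthogonal_matrix_id)

lemma conj_class_reflection: "conj_class {mat 1, - half_turn i} = conj_class Z2_minus"
  using conj_class_shift[of "{mat 1, - half_turn i}" "i - 3"]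
  by (simp add: Z2_minus_def rotation_e3_half_turn shift_half_turn shift_one half_turn_in_O3
       orthogonal_matrix_id orthogonal_uminus)

lemma conj_class_D2_z:
  "conj_class (insert (mat 1) (insert (half_turn i) {- half_turn j | j. j \<noteq> i})) = conj_class D2_z"
proof -
  have "(\<lambda>A. monomial (\<lambda>_. 1) (i - 3) ** A ** transpose (monomial (\<lambda>_. 1) (i - 3))) ` {- half_turn j | j. j \<noteq> i}
    = {- half_turn j | j. j \<noteq> 3}" (is "?L = ?R")
  proof
    show "?L \<subseteq> ?R"
    proof safe
      fix j assume "j \<noteq> i"
      then have "j - (i - 3) \<noteq> 3" by (simp add: algebra_simps)
      then show "\<exists>l. monomial (\<lambda>_. 1) (i - 3) ** - half_turn j ** transpose (monomial (\<lambda>_. 1) (i - 3))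
          = - half_turn l \<and> l \<noteq> 3"
        by (intro exI[of _ "j - (i - 3)"]) (simp only: uminus_matrix_mult shift_half_turn simp_thms)
    qed
    show "?R \<subseteq> ?L"
    proof safe
      fix j :: 3 assume "j \<noteq> 3"
      then have "j + (i - 3) \<noteq> i" by (simp add: algebra_simps)
      then show "- half_turn j \<in> ?L"
        by (intro image_eqI[of _ _ "- half_turn (j + (i - 3))"])
          (simp only: uminus_matrix_mult shift_half_turn add_diff_cancel_right', blast)
    qed
  qed
  moreover have "insert (mat 1) (insert (half_turn i) {- half_turn j | j. j \<noteq> i}) \<subseteq> carrier O3"
    by (auto simp: orthogonal_matrix_id half_turn_in_O3 orthogonal_uminus)
  ultimately show ?thesis
    using conj_class_shift[of "insert (mat 1) (insert (half_turn i) {- half_turn j | j. j \<noteq> i})" "i - 3"]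
    by (simp add: D2_z_half_turn shift_half_turn shift_one)
qed

section \<open>Intersections of diagonal sign matrices\<close>

text \<open>When all cyclic parts are trivial only diagonal sign matrices remain, and \<open>- mat 1\<close>
  is excluded because it is not in \<open>D_d_grp n\<close>.\<close>
lemma pullback_cases:
  assumes n: "n \<ge> 2" and g: "orthogonal_matrix g"
    and diag: "\<forall>s k. monomial s k \<in> pullback n g \<longrightarrow> k = 0"
    and A: "A \<in> pullback n g"
  obtains (one) "A = mat 1" | (half_turn) i where "A = half_turn i" | (reflection) i where "A = - half_turn i"
proof -
  obtain s k where s: "s \<in> signs" and A_eq: "A = monomial s k"
    using A by (rule pullback_monomial)
  have k: "k = 0"
    using diag A unfolding A_eq by blast
  have "A \<noteq> - mat 1"
    using A minus_one_notin_pullback[OF n g] by auto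
  with s show thesis
    using that unfolding A_eq k by (cases rule: diagonal_cases) auto
qed

lemma pullback_half_turn_mult:
  assumes n: "n \<ge> 2" and g: "orthogonal_matrix g" and ij: "i \<noteq> j"
  shows "half_turn i \<in> pullback n g \<Longrightarrow> half_turn j \<in> pullback n g \<Longrightarrow> half_turn (- i - j) \<in> pullback n g"
    and "half_turn i \<in> pullback n g \<Longrightarrow> - half_turn j \<in> pullback n g \<Longrightarrow> - half_turn (- i - j) \<in> pullback n g"
    and "- half_turn i \<in> pullback n g \<Longrightarrow> - half_turn j \<in> pullback n g \<Longrightarrow> half_turn (- i - j) \<in> pullback n g"
  using pullback_mult[OF n g] half_turn_mult[of i j] ij
  by (metis uminus_matrix_mult minus_minus)+

text \<open>The product of the two is \<open>- mat 1\<close>.\<close>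
lemma half_turn_one_sign:
  assumes n: "n \<ge> 2" and g: "orthogonal_matrix g"
    and "half_turn i \<in> pullback n g" "- half_turn i \<in> pullback n g"
  shows False
  using pullback_mult[OF n g assms(3,4)] minus_one_notin_pullback[OF n g] by (simp add: half_turn_mult)

text \<open>All three conjugated half-turns have determinant \<open>1\<close>, so their indices
  \<open>m\<close> are even. The product of two half-turns about horizontal axes is a rotation
  about \<open>e3\<close>, so at least one of the three is a rotation about \<open>e3\<close>; as
  it has trace \<open>- 1\<close>, its angle \<open>m \<pi> / n\<close> is an odd multiple of
  \<open>\<pi>\<close>, and \<open>m\<close> is an odd multiple of \<open>n\<close>.\<close>
lemma even_if_all_half_turns:
  assumes n: "n \<ge> 2" and g: "orthogonal_matrix g" and all: "\<And>i. half_turn i \<in> pullback n g"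
  shows "even n"
proof -
  have form: "\<exists>m b. g ** half_turn i ** transpose g = dihedral (of_int m * pi / n) b \<and> even m" for i
  proof -
    obtain m b where eq: "g ** half_turn i ** transpose g = (- 1) powi m *\<^sub>R dihedral (of_int m * pi / n) b"
      using all[of i] unfolding pullback_def D_d_grp_dihedral[OF n] by blast
    have "det (g ** half_turn i ** transpose g) = 1"
      by (simp add: det_conj g half_turn_det)
    then have "((- 1) powi m) ^ 3 = (1 :: real)"
      by (simp add: eq det_scaleR det_dihedral)
    then have "even m"
      by (auto simp: power_int_minus_left split: if_splits)
    then show ?thesis
      using eq by (auto simp: power_int_minus_left)
  qed
  \<comment> \<open>\<open>- 1 - 2\<close> is the index of the third axis.\<close>
  obtain i m where m: "g ** half_turn i ** transpose g = dihedral (of_int m * pi / n) False" "even m"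
  proof -
    obtain m1 b1 where 1: "g ** half_turn 1 ** transpose g = dihedral (of_int m1 * pi / n) b1" "even m1"
      using form by blast
    obtain m2 b2 where 2: "g ** half_turn 2 ** transpose g = dihedral (of_int m2 * pi / n) b2" "even m2"
      using form by blast
    show thesis
    proof (cases "b1 \<and> b2")
      case False
      then show thesis using that 1 2 by auto
    next
      case True
      have "g ** half_turn (- 1 - 2) ** transpose g = (g ** half_turn 1 ** transpose g) ** (g ** half_turn 2 ** transpose g)"
        by (simp add: mult_conj g half_turn_mult)
      also have "\<dots> = dihedral (of_int (m1 - m2) * pi / n) False"
        unfolding 1 2 using True by (simp add: dihedral_mult ring_distribs diff_divide_distrib)
      finally have "g ** half_turn (- 1 - 2) ** transpose g = dihedral (of_int (m1 - m2) * pi / n) False" .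
      from that[OF this] show thesis
        using 1(2) 2(2) by simp
    qed
  qed
  have "1 + 2 * cos (of_int m * pi / n) = - 1"
    using arg_cong[OF m(1), of trace] by (simp add: trace_conj g half_turn_trace trace_dihedral)
  then have "cos (of_int m * pi / n) = cos pi"
    by simp
  then obtain l :: int where "of_int m * pi / n = pi + 2 * of_int l * pi \<or> of_int m * pi / n = - pi + 2 * of_int l * pi"
    unfolding cos_eq by (auto elim!: Ints_cases)
  then have "of_int m * pi = of_int (int n * (1 + 2 * l)) * pi
      \<or> of_int m * pi = of_int (int n * (2 * l - 1)) * pi"
  proof (elim disjE)
    assume "of_int m * pi / n = pi + 2 * of_int l * pi"
    then show ?thesis using n by (intro disjI1) (simp add: field_simps)
  next
    assume "of_int m * pi / n = - pi + 2 * of_int l * pi"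
    then show ?thesis using n by (intro disjI2) (simp add: field_simps)
  qed
  then have "m = int n * (1 + 2 * l) \<or> m = int n * (2 * l - 1)"
    by (simp only: mult_cancel_right pi_neq_zero of_int_eq_iff simp_thms)
  then show ?thesis
    using m(2) by auto
qed

lemma pullback_eq_D2:
  assumes n: "n \<ge> 2" and g: "orthogonal_matrix g"
    and diag: "\<forall>s k. monomial s k \<in> pullback n g \<longrightarrow> k = 0"
    and all: "\<And>i. half_turn i \<in> pullback n g"
  shows "pullback n g = insert (mat 1) (range half_turn)"
proof -
  have "A \<in> insert (mat 1) (range half_turn)" if A: "A \<in> pullback n g" for A
  proof -
    consider (one) "A = mat 1" | (half_turn) i where "A = half_turn i"
      | (reflection) i where "A = - half_turn i"
      using pullback_cases[OF n g diag A] .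
    then show ?thesis
    proof cases
      case (reflection i)
      then show ?thesis
        using half_turn_one_sign[OF n g all[of i]] A by simp
    qed auto
  qed
  then show ?thesis
    using pullback_one[OF n g] all by auto
qed

lemma pullback_eq_D2_z:
  assumes n: "n \<ge> 2" and g: "orthogonal_matrix g"
    and diag: "\<forall>s k. monomial s k \<in> pullback n g \<longrightarrow> k = 0"
    and a: "half_turn a \<in> pullback n g" "\<And>l. l \<noteq> a \<Longrightarrow> - half_turn l \<in> pullback n g"
  shows "pullback n g = insert (mat 1) (insert (half_turn a) {- half_turn l | l. l \<noteq> a})"
proof -
  have "A = mat 1 \<or> A = half_turn a \<or> (\<exists>l. l \<noteq> a \<and> A = - half_turn l)" if A: "A \<in> pullback n g" for A
  proof -
    consider (one) "A = mat 1" | (half_turn) i where "A = half_turn i"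
      | (reflection) i where "A = - half_turn i"
      using pullback_cases[OF n g diag A] .
    then show ?thesis
    proof cases
      case (half_turn i)
      then have "i = a"
        using half_turn_one_sign[OF n g] a(2) A by auto
      then show ?thesis using half_turn by simp
    next
      case (reflection i)
      then have "i \<noteq> a"
        using half_turn_one_sign[OF n g] a(1) A by auto
      then show ?thesis using reflection by auto
    qed simp
  qed
  then show ?thesis
    using pullback_one[OF n g] a by auto
qed

text \<open>In the diagonal case the group is determined by which axes contribute an element and with which
  sign: none, one, or (as two determine the third) all of them. With three axes the product rule
  for signs leaves three half-turns, or one half-turn and two reflections.\<close>
lemma conj_class_pullback_in:
  assumes n: "n \<ge> 2" and g: "orthogonal_matrix g"
  shows "conj_class (pullback n g) \<in>
    {conj_class trivial_group, conj_class (Z_grp 2), conj_class (Z_grp (gcd n 3)),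
     conj_class (D_grp (gcd n 2)), conj_class Z2_minus, conj_class D2_z}"
proof (cases "\<exists>s k. monomial s k \<in> pullback n g \<and> k \<noteq> 0")
  case True
  then have "3 dvd n" "conj_class (pullback n g) = conj_class (Z_grp 3)"
    using pullback_order_3[OF n g] by blast+
  moreover have "gcd n 3 = 3"
    using \<open>3 dvd n\<close> by (simp add: gcd_nat.absorb2)
  ultimately show ?thesis by simp
next
  case False
  let ?K = "pullback n g"
  have diag: "\<forall>s k. monomial s k \<in> ?K \<longrightarrow> k = 0"
    using False by blast
  have sub: "A = mat 1 \<or> (\<exists>i. A = half_turn i) \<or> (\<exists>i. A = - half_turn i)" if "A \<in> ?K" for A
    using pullback_cases[OF n g diag that] by blast
  note one = pullback_one[OF n g] and both = half_turn_one_sign[OF n g]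
    and mult = pullback_half_turn_mult[OF n g]
  show ?thesis
  proof (cases "\<exists>i j. i \<noteq> j \<and> (half_turn i \<in> ?K \<or> - half_turn i \<in> ?K) \<and> (half_turn j \<in> ?K \<or> - half_turn j \<in> ?K)")
    case False
    show ?thesis
    proof (cases "\<exists>i. half_turn i \<in> ?K \<or> - half_turn i \<in> ?K")
      case True
      then obtain i where i: "half_turn i \<in> ?K \<or> - half_turn i \<in> ?K" ..
      then have only: "half_turn j \<notin> ?K \<and> - half_turn j \<notin> ?K" if "j \<noteq> i" for j
        using False that by blast
      from i show ?thesis
      proof
        assume i: "half_turn i \<in> ?K"
        have "A = mat 1 \<or> A = half_turn i" if A: "A \<in> ?K" for A
          using sub[OF A] only both[of i] i A by metis
        then have "?K = {mat 1, half_turn i}"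
          using one i by auto
        then show ?thesis by (simp add: conj_class_half_turn)
      next
        assume i: "- half_turn i \<in> ?K"
        have "A = mat 1 \<or> A = - half_turn i" if A: "A \<in> ?K" for A
          using sub[OF A] only both[of i] i A by metis
        then have "?K = {mat 1, - half_turn i}"
          using one i by auto
        then show ?thesis by (simp add: conj_class_reflection)
      qed
    next
      case False
      then have "?K = trivial_group"
        unfolding trivial_group_def using sub one by auto
      then show ?thesis by simp
    qed
  next
    case True
    then obtain i j where ij: "i \<noteq> j" "half_turn i \<in> ?K \<or> - half_turn i \<in> ?K" "half_turn j \<in> ?K \<or> - half_turn j \<in> ?K"
      by blast
    have third: "l = i \<or> l = j \<or> l = - i - j" for l
      using exhaust_3[of i] exhaust_3[of j] exhaust_3[of l] ij(1) by auto
    have distinct: "- i - j \<noteq> i" "- i - j \<noteq> j"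
      using exhaust_3[of i] exhaust_3[of j] ij(1) by auto
    have comm: "- j - i = - i - j" by simp
    show ?thesis
    proof (cases "\<forall>l. half_turn l \<in> ?K")
      case True
      then have "?K = insert (mat 1) (range half_turn)"
        using pullback_eq_D2[OF n g diag] by blast
      moreover have "gcd n 2 = 2"
        using even_if_all_half_turns[OF n g] True by (simp add: gcd_nat.absorb2)
      ultimately show ?thesis
        by (simp add: D_grp_2)
    next
      case False
      have "\<exists>a. half_turn a \<in> ?K \<and> (\<forall>l. l \<noteq> a \<longrightarrow> - half_turn l \<in> ?K)"
        using ij(2,3)
      proof (elim disjE)
        assume "half_turn i \<in> ?K" "half_turn j \<in> ?K"
        then show ?thesis using mult(1)[OF ij(1)] third False by metis
      next
        assume "half_turn i \<in> ?K" "- half_turn j \<in> ?K"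
        then show ?thesis using mult(2)[OF ij(1)] third by metis
      next
        assume "- half_turn i \<in> ?K" "half_turn j \<in> ?K"
        then show ?thesis using mult(2)[OF ij(1)[symmetric]] third comm by metis
      next
        assume "- half_turn i \<in> ?K" "- half_turn j \<in> ?K"
        then show ?thesis using mult(3)[OF ij(1)] third by metis
      qed
      then obtain a where a: "half_turn a \<in> ?K" "\<forall>l. l \<noteq> a \<longrightarrow> - half_turn l \<in> ?K"
        by blast
      then have "?K = insert (mat 1) (insert (half_turn a) {- half_turn l | l. l \<noteq> a})"
        using pullback_eq_D2_z[OF n g diag] by blast
      then show ?thesis
        by (simp add: conj_class_D2_z)
    qed
  qed
qed

section \<open>Frames that realize each class\<close>

text \<open>Every element of \<open>D_d_grp n\<close> maps \<open>e3\<close> to \<open>\<plusminus>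
  e3\<close>. Seen from the tetrahedral frame this is a strong restriction on the elements of
  \<open>pullback n g\<close>, which depends on \<open>g\<close> only through \<open>v\<close>.\<close>
lemma pullback_axis:
  assumes n: "n \<ge> 2" and g: "orthogonal_matrix g" and A: "A \<in> pullback n g"
    and v: "v = transpose g *v e3"
  shows "A *v v = v \<or> A *v v = - v"
proof -
  have 1: "transpose g ** g = mat 1"
    using g by (simp add: orthogonal_matrix)
  have "(g ** A ** transpose g) *v e3 = e3 \<or> (g ** A ** transpose g) *v e3 = - e3"
    using D_d_grp_mult_e3[OF n] A by (simp add: pullback_def)
  then have "g *v (A *v v) = e3 \<or> g *v (A *v v) = - e3"
    by (simp add: v matrix_vector_mul_assoc matrix_mul_assoc del: transpose_matrix_vector)
  then have "transpose g *v (g *v (A *v v)) = v \<or> transpose g *v (g *v (A *v v)) = - v"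
    by (auto simp: v mult_vec_uminus simp del: transpose_matrix_vector)
  then show ?thesis
    by (simp add: matrix_vector_mul_assoc matrix_mul_assoc 1 del: transpose_matrix_vector)
qed

text \<open>A signed matrix with nontrivial cyclic part has \<open>v\<close> as an eigenvector for
  \<open>\<plusminus> 1\<close> only if all coordinates of \<open>v\<close> agree up to sign, as a
  nontrivial cyclic permutation of three indices is transitive.\<close>
lemma pullback_diagonal:
  assumes n: "n \<ge> 2" and g: "orthogonal_matrix g" and v: "v = transpose g *v e3"
    and ne: "(v $ a)\<^sup>2 \<noteq> (v $ b)\<^sup>2" and A: "monomial s k \<in> pullback n g"
  shows "k = 0"
proof (rule ccontr)
  assume k: "k \<noteq> 0"
  have s: "s \<in> signs"
    using A by (auto simp: pullback_def intro: monomial_in_oplus)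
  have "(v $ (i + k))\<^sup>2 = (v $ i)\<^sup>2" for i
  proof -
    have "(s i * v $ (i + k))\<^sup>2 = (v $ i)\<^sup>2"
      using pullback_axis[OF n g A v] by (auto simp: monomial_mult_vec vec_eq_iff)
    moreover have "(s i)\<^sup>2 = 1"
      using s by (auto simp: signs_def dest: spec[of _ i])
    ultimately show ?thesis by (simp add: power_mult_distrib)
  qed
  note cyc = this[of 1] this[of 2] this[of 3]
  show False
  proof -
    \<comment> \<open>The sums \<open>i + k\<close> are computed as numerals and have to be reduced modulo 3.\<close>
    have "v $ 4 = v $ 1" "v $ 5 = v $ 2"
      by (rule arg_cong[of _ _ "\<lambda>i. v $ i"], simp)+
    then show ?thesis
      using k cyc ne exhaust_3[of k] exhaust_3[of a] exhaust_3[of b] by auto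
  qed
qed

lemma half_turn_axis:
  assumes n: "n \<ge> 2" and g: "orthogonal_matrix g" and v: "v = transpose g *v e3"
    and A: "half_turn i \<in> pullback n g \<or> - half_turn i \<in> pullback n g"
  shows "v $ i = 0 \<or> (\<forall>j. j \<noteq> i \<longrightarrow> v $ j = 0)"
proof -
  have "half_turn i *v v = v \<or> half_turn i *v v = - v"
    using pullback_axis[OF n g _ v, of "half_turn i"] pullback_axis[OF n g _ v, of "- half_turn i"] A
    by (metis uminus_mult_vec minus_minus)
  then have "(\<forall>j. axis_signs i j * v $ j = v $ j) \<or> (\<forall>j. axis_signs i j * v $ j = - v $ j)"
    by (simp add: half_turn_def monomial_mult_vec vec_eq_iff)
  then show ?thesis
  proof
    assume *: "\<forall>j. axis_signs i j * v $ j = v $ j"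
    have "v $ j = 0" if "j \<noteq> i" for j
      using that *[rule_format, of j] by (simp add: axis_signs_def)
    then show ?thesis by blast
  next
    assume *: "\<forall>j. axis_signs i j * v $ j = - v $ j"
    then show ?thesis
      using *[rule_format, of i] by (simp add: axis_signs_def)
  qed
qed

text \<open>The rational orthogonal matrix below has third row \<open>(-1, 2, 2) / 3\<close>. No coordinate
  vanishes, which excludes half-turns and reflections, and the coordinates do not all agree up to
  sign.\<close>
lemma exists_pullback_trivial:
  assumes n: "n \<ge> 2"
  shows "\<exists>g. orthogonal_matrix g \<and> pullback n g = trivial_group"
proof -
  define g :: mat3 where
    "g = vector [vector [2/3, -1/3, 2/3], vector [2/3, 2/3, -1/3], vector [-1/3, 2/3, 2/3]]"
  have g: "orthogonal_matrix g"
    by (simp add: orthogonal_matrix g_def vec_eq_iff forall_3 matrix_matrix_mult_def transpose_def sum_3 mat_def)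
  define v where "v = transpose g *v e3"
  have v: "v $ 1 = - 1 / 3" "v $ 2 = 2 / 3" "v $ 3 = 2 / 3"
    by (simp_all add: v_def mult_transpose_e3 g_def del: transpose_matrix_vector)
  have "(v $ 1)\<^sup>2 \<noteq> (v $ 2)\<^sup>2"
    by (simp add: v power2_eq_square)
  then have diag: "\<forall>s k. monomial s k \<in> pullback n g \<longrightarrow> k = 0"
    using pullback_diagonal[OF n g v_def] by blast
  have no: "half_turn i \<notin> pullback n g \<and> - half_turn i \<notin> pullback n g" for i
  proof -
    have "\<not> (v $ i = 0 \<or> (\<forall>j. j \<noteq> i \<longrightarrow> v $ j = 0))"
      using exhaust_3[of i] by (auto simp: v forall_3)
    then show ?thesis
      using half_turn_axis[OF n g v_def] by blast
  qed
  have "A = mat 1" if A: "A \<in> pullback n g" for A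
    by (cases rule: pullback_cases[OF n g diag A]) (use no A in auto)
  then have "pullback n g = trivial_group"
    unfolding trivial_group_def using pullback_one[OF n g] by blast
  then show ?thesis using g by blast
qed

text \<open>The sign of \<open>(- 1) powi m\<close> decides which of the half-turn and its negative, a
  reflection, occurs.\<close>
lemma signed_half_turn_in_pullback:
  assumes n: "n \<ge> 2" and "g ** half_turn i ** transpose g = dihedral (of_int m * pi / n) b"
  shows "(- 1) powi m *\<^sub>R half_turn i \<in> pullback n g"
proof -
  have "g ** ((- 1) powi m *\<^sub>R half_turn i) ** transpose g = (- 1) powi m *\<^sub>R dihedral (of_int m * pi / n) b"
    using assms(2) by (simp add: power_int_minus_left)
  then have "g ** ((- 1) powi m *\<^sub>R half_turn i) ** transpose g \<in> D_d_grp n"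
    unfolding D_d_grp_dihedral[OF n] by blast
  then show ?thesis
    using half_turn_in_oplus[of i] by (simp add: pullback_def power_int_minus_left)
qed

text \<open>The frame shares only its first axis with \<open>D_d_grp n\<close>. The rotation
  \<open>R\<close> puts this axis at the angle \<open>m \<pi> / (2 n)\<close>, an axis of
  half-turns for \<open>m = 0\<close> and the normal of a mirror plane for \<open>m = 1\<close>;
  the rotation \<open>Q\<close> about it, by the angle of the triangle with sides 3, 4 and 5,
  moves the other two axes to general position.\<close>
lemma exists_pullback_order_2:
  assumes n: "n \<ge> 2"
  shows "\<exists>g. orthogonal_matrix g \<and> pullback n g = {mat 1, (- 1) powi m *\<^sub>R half_turn 1}"
proof -
  define Q :: mat3 where
    "Q = vector [vector [1, 0, 0], vector [0, 4/5, -3/5], vector [0, 3/5, 4/5]]"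
  define R where "R = dihedral (of_int m * pi / (2 * n)) False"
  define g where "g = R ** Q"
  have Q: "orthogonal_matrix Q"
    by (simp add: orthogonal_matrix Q_def vec_eq_iff forall_3 matrix_matrix_mult_def transpose_def sum_3 mat_def)
  have R: "orthogonal_matrix R"
    by (simp add: orthogonal_matrix R_def transpose_dihedral dihedral_mult mat_1_dihedral)
  have g: "orthogonal_matrix g"
    unfolding g_def using R Q by (rule orthogonal_matrix_mul)
  define v where "v = transpose g *v e3"
  have "v = transpose Q *v (transpose R *v e3)"
    by (simp add: v_def g_def matrix_transpose_mul matrix_vector_mul_assoc del: transpose_matrix_vector)
  also have "transpose R *v e3 = e3"
    by (simp add: R_def transpose_dihedral dihedral_mult_e3 del: transpose_matrix_vector)
  finally have v: "v $ 1 = 0" "v $ 2 = 3 / 5" "v $ 3 = 4 / 5"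
    by (simp_all add: mult_transpose_e3 Q_def del: transpose_matrix_vector)
  have "(v $ 2)\<^sup>2 \<noteq> (v $ 3)\<^sup>2"
    by (simp add: v power2_eq_square)
  then have diag: "\<forall>s k. monomial s k \<in> pullback n g \<longrightarrow> k = 0"
    using pullback_diagonal[OF n g v_def] by blast
  have no: "half_turn i \<notin> pullback n g \<and> - half_turn i \<notin> pullback n g" if "i \<noteq> 1" for i
  proof -
    have "\<not> (v $ i = 0 \<or> (\<forall>j. j \<noteq> i \<longrightarrow> v $ j = 0))"
      using exhaust_3[of i] that by (auto simp: v forall_3)
    then show ?thesis
      using half_turn_axis[OF n g v_def] by blast
  qed
  have "Q ** half_turn 1 ** transpose Q = half_turn 1"
    unfolding half_turn_1_dihedral
    by (simp add: dihedral_def Q_def vec_eq_iff forall_3 matrix_matrix_mult_def transpose_def sum_3)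
  then have "g ** half_turn 1 ** transpose g = R ** half_turn 1 ** transpose R"
    by (metis g_def matrix_transpose_mul matrix_mul_assoc)
  also have "\<dots> = dihedral (of_int m * pi / n) True"
    by (simp add: R_def half_turn_1_dihedral transpose_dihedral dihedral_mult mult.commute)
  finally have mem: "(- 1) powi m *\<^sub>R half_turn 1 \<in> pullback n g"
    by (rule signed_half_turn_in_pullback[OF n])
  have "A \<in> {mat 1, (- 1) powi m *\<^sub>R half_turn 1}" if A: "A \<in> pullback n g" for A
  proof -
    consider (one) "A = mat 1" | (half_turn) i where "A = half_turn i"
      | (reflection) i where "A = - half_turn i"
      using pullback_cases[OF n g diag A] .
    then show ?thesis
    proof cases
      case (half_turn i)
      then have "i = 1" using no A by auto
      then show ?thesis
        using half_turn A mem half_turn_one_sign[OF n g, of 1] by (cases "even m") (auto simp: power_int_minus_left)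
    next
      case (reflection i)
      then have "i = 1" using no A by auto
      then show ?thesis
        using reflection A mem half_turn_one_sign[OF n g, of 1] by (cases "even m") (auto simp: power_int_minus_left)
    qed simp
  qed
  then have "pullback n g = {mat 1, (- 1) powi m *\<^sub>R half_turn 1}"
    using pullback_one[OF n g] mem by auto
  then show ?thesis using g by blast
qed

text \<open>In a frame with third axis \<open>e3\<close> whose first axis is at angle \<open>m \<pi> / (2
  n)\<close>, the rotation by \<open>\<pi>\<close> about \<open>e3\<close> has index
  \<open>n\<close> in \<open>D_d_grp_dihedral\<close>. So the parity of \<open>n\<close> decides
  between a half-turn about \<open>e3\<close> and a reflection in the horizontal plane.\<close>
lemma aligned_frame:
  fixes m :: int
  assumes n: "n \<ge> 2" and g_def: "g = dihedral (of_int m * pi / (2 * n)) False"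
  shows "orthogonal_matrix g" and "\<forall>s k. monomial s k \<in> pullback n g \<longrightarrow> k = 0"
    and "(- 1) powi m *\<^sub>R half_turn 1 \<in> pullback n g" and "(- 1) powi (int n) *\<^sub>R half_turn 3 \<in> pullback n g"
proof -
  show g: "orthogonal_matrix g"
    by (simp add: orthogonal_matrix g_def transpose_dihedral dihedral_mult mat_1_dihedral)
  show "\<forall>s k. monomial s k \<in> pullback n g \<longrightarrow> k = 0"
  proof -
    have "e3 = transpose g *v e3"
      by (simp add: g_def transpose_dihedral dihedral_mult_e3 del: transpose_matrix_vector)
    moreover have "(e3 $ 1)\<^sup>2 \<noteq> (e3 $ 3)\<^sup>2"
      by (simp add: axis_def)
    ultimately show ?thesis
      using pullback_diagonal[OF n g] by blast
  qed
  show "(- 1) powi m *\<^sub>R half_turn 1 \<in> pullback n g"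
    by (rule signed_half_turn_in_pullback[OF n, of _ _ _ True])
      (simp add: g_def half_turn_1_dihedral transpose_dihedral dihedral_mult mult.commute)
  show "(- 1) powi (int n) *\<^sub>R half_turn 3 \<in> pullback n g"
    by (rule signed_half_turn_in_pullback[OF n, of _ _ _ False])
      (use n in \<open>simp add: g_def half_turn_3_dihedral transpose_dihedral dihedral_mult\<close>)
qed

lemma exists_pullback_D2:
  assumes n: "n \<ge> 2" and "even n"
  shows "\<exists>g. orthogonal_matrix g \<and> pullback n g = D_grp 2"
proof -
  define g where "g = dihedral (of_int 0 * pi / (2 * real n)) False"
  note frame = aligned_frame[OF n g_def]
  have 1: "half_turn 1 \<in> pullback n g" and 3: "half_turn 3 \<in> pullback n g"
    using frame(3,4) \<open>even n\<close> by (simp_all add: power_int_minus_left)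
  have "half_turn 2 \<in> pullback n g"
    using pullback_half_turn_mult(1)[OF n frame(1) third_index(3) 1 3] unfolding third_index .
  then have "half_turn i \<in> pullback n g" for i
    using 1 3 exhaust_3[of i] by auto
  then have "pullback n g = D_grp 2"
    unfolding D_grp_2 by (intro pullback_eq_D2[OF n frame(1)] frame(2))
  then show ?thesis using frame(1) by blast
qed

text \<open>One half-turn and one reflection are needed among the first and third axes. For even
  \<open>n\<close> the third axis gives the half-turn, so the first has to give a reflection; for
  odd \<open>n\<close> it is the other way round.\<close>
lemma exists_pullback_D2_z:
  assumes n: "n \<ge> 2"
  shows "\<exists>g. orthogonal_matrix g \<and> conj_class (pullback n g) = conj_class D2_z"
proof -
  define m :: int where "m = (if even n then 1 else 0)"
  define g where "g = dihedral (of_int m * pi / (2 * real n)) False"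
  note frame = aligned_frame[OF n g_def]
  have "\<exists>a. half_turn a \<in> pullback n g \<and> (\<forall>l. l \<noteq> a \<longrightarrow> - half_turn l \<in> pullback n g)"
  proof (cases "even n")
    case True
    have 1: "- half_turn 1 \<in> pullback n g" and 3: "half_turn 3 \<in> pullback n g"
      using frame(3,4) True by (simp_all add: power_int_minus_left m_def)
    have "- half_turn 2 \<in> pullback n g"
      using pullback_half_turn_mult(2)[OF n frame(1) third_index(4) 3 1] unfolding third_index .
    then show ?thesis
      using 1 3 by (intro exI[of _ 3]) (auto simp: forall_3)
  next
    case False
    have 1: "half_turn 1 \<in> pullback n g" and 3: "- half_turn 3 \<in> pullback n g"
      using frame(3,4) False by (simp_all add: power_int_minus_left m_def)
    have "- half_turn 2 \<in> pullback n g"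
      using pullback_half_turn_mult(2)[OF n frame(1) third_index(3) 1 3] unfolding third_index .
    then show ?thesis
      using 1 3 by (intro exI[of _ 1]) (auto simp: forall_3)
  qed
  then obtain a where "half_turn a \<in> pullback n g" "\<And>l. l \<noteq> a \<Longrightarrow> - half_turn l \<in> pullback n g"
    by blast
  then have "pullback n g = insert (mat 1) (insert (half_turn a) {- half_turn l | l. l \<noteq> a})"
    by (intro pullback_eq_D2_z[OF n frame(1)] frame(2))
  then have "conj_class (pullback n g) = conj_class D2_z"
    by (simp only: conj_class_D2_z)
  then show ?thesis
    using frame(1) by blast
qed

text \<open>A rotation matrix preserves the inner and cross products in Rodrigues' formula.\<close>
lemma rotation_conj:
  assumes A: "rotation_matrix A"
  shows "A ** rotation u t ** transpose A = rotation (A *v u) t"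
proof -
  have orth: "orthogonal_matrix A"
    using A by (simp add: rotation_matrix_def)
  then have AT: "A ** transpose A = mat 1"
    by (simp add: orthogonal_matrix_def)
  have trans: "orthogonal_transformation ((*v) A)"
    using orth by (simp add: orthogonal_transformation_matrix)
  have "(A ** rotation u t ** transpose A) *v x = rotation (A *v u) t *v x" for x
  proof -
    define y where "y = transpose A *v x"
    have x: "x = A *v y"
      by (simp add: y_def matrix_vector_mul_assoc AT del: transpose_matrix_vector)
    have norm: "norm (A *v u) = norm u"
      using trans by (simp add: orthogonal_transformation_norm)
    have inner: "(A *v a) \<bullet> (A *v b) = a \<bullet> b" for a b
      using trans by (simp add: orthogonal_transformation_def)
    have scale: "(A *v u) /\<^sub>R norm u = A *v (u /\<^sub>R norm u)"
      by (simp add: matrix_vector_mult_scaleR)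
    have "(A ** rotation u t ** transpose A) *v x = A *v (rotation u t *v y)"
      by (simp add: y_def matrix_vector_mul_assoc matrix_mul_assoc del: transpose_matrix_vector)
    also have "\<dots> = rotation (A *v u) t *v x"
      unfolding x rotation_mult_vec norm scale inner cross_rotation_matrix[OF A]
      by (simp add: matrix_vector_right_distrib matrix_vector_mult_scaleR)
    finally show ?thesis .
  qed
  then show ?thesis
    by (simp add: matrix_eq)
qed

lemma rotation_normalize: "rotation (u /\<^sub>R norm u) t = rotation u t"
  by (cases "u = 0") (simp_all add: rotation_def)

text \<open>A rotation carrying the diagonal of the cube to \<open>e3\<close> turns the rotation by
  \<open>2\<pi>/3\<close> about this diagonal into the one about \<open>e3\<close>, which has the
  even index \<open>2 n / 3\<close> in \<open>D_d_grp_dihedral\<close>. The class is then known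
  from \<open>pullback_order_3\<close>.\<close>
lemma exists_pullback_Z3:
  assumes n: "n \<ge> 2" and "3 dvd n"
  shows "\<exists>g. orthogonal_matrix g \<and> conj_class (pullback n g) = conj_class (Z_grp 3)"
proof -
  let ?d = "e1 + e2 + e3"
  have "norm (?d /\<^sub>R norm ?d) = 1"
    using e1_plus_e2_plus_e3_nonzero by simp
  then obtain A where A: "rotation_matrix A" "A *v e3 = ?d /\<^sub>R norm ?d"
    using rotation_matrix_exists_basis[of "?d /\<^sub>R norm ?d" 3] by auto
  then have "orthogonal_matrix A"
    by (simp add: rotation_matrix_def)
  then have AT: "transpose A ** A = mat 1" and g: "orthogonal_matrix (transpose A)"
    by (simp add: orthogonal_matrix, simp only: orthogonal_matrix_transpose)
  have "monomial (\<lambda>_. 1) 2 = A ** rotation e3 (2 * pi / 3) ** transpose A"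
    unfolding rotation_conj[OF A(1)] A(2) rotation_normalize rotation_diagonal_monomial ..
  then have "transpose A ** monomial (\<lambda>_. 1) 2 ** transpose (transpose A)
      = (transpose A ** A) ** rotation e3 (2 * pi / 3) ** (transpose A ** A)"
    by (simp add: matrix_mul_assoc)
  also have "\<dots> = dihedral (2 * pi / 3) False"
    by (simp add: AT rotation_e3_dihedral)
  finally have "transpose A ** monomial (\<lambda>_. 1) 2 ** transpose (transpose A) = dihedral (2 * pi / 3) False" .
  moreover obtain l where l: "n = 3 * l"
    using \<open>3 dvd n\<close> ..
  have "dihedral (2 * pi / 3) False = (- 1) powi (2 * int l) *\<^sub>R dihedral (of_int (2 * int l) * pi / n) False"
    using n by (simp add: l power_int_minus_left)
  then have "dihedral (2 * pi / 3) False \<in> D_d_grp n"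
    unfolding D_d_grp_dihedral[OF n] by blast
  ultimately have "monomial (\<lambda>_. 1) 2 \<in> pullback n (transpose A)"
    using signs_simps(1) by (auto simp: pullback_def oplus_Z2c_T)
  then have "conj_class (pullback n (transpose A)) = conj_class (Z_grp 3)"
    using pullback_order_3(2)[OF n g] by simp
  then show ?thesis using g by blast
qed

section \<open>The clips operation\<close>

theorem lemma4p15:
  fixes n :: nat
  assumes "n \<ge> 2"
  shows "conj_class (D_d_grp n) \<circledcirc> conj_class (oplus_Z2c T_grp) =
    {conj_class trivial_group, conj_class (Z_grp 2), conj_class (Z_grp (gcd n 3)),
     conj_class (D_grp (gcd n 2)), conj_class Z2_minus, conj_class D2_z}"
proof -
  let ?C = "{conj_class (pullback n g) | g. orthogonal_matrix g}"
  have in_C: "conj_class (pullback n g) \<in> ?C" if "orthogonal_matrix g" for g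
    using that by blast
  have triv: "conj_class trivial_group \<in> ?C"
  proof -
    obtain g where "orthogonal_matrix g" "pullback n g = trivial_group"
      using exists_pullback_trivial[OF assms] by blast
    then show ?thesis using in_C[of g] by simp
  qed
  have Z2: "conj_class (Z_grp 2) \<in> ?C"
  proof -
    obtain g where "orthogonal_matrix g" "pullback n g = {mat 1, half_turn 1}"
      using exists_pullback_order_2[OF assms, of 0] by auto
    then show ?thesis
      using in_C[of g] by (simp only: conj_class_half_turn)
  qed
  have Z2m: "conj_class Z2_minus \<in> ?C"
  proof -
    obtain g where "orthogonal_matrix g" "pullback n g = {mat 1, - half_turn 1}"
      using exists_pullback_order_2[OF assms, of 1] by auto
    then show ?thesis
      using in_C[of g] by (simp only: conj_class_reflection)
  qed
  have Z3: "conj_class (Z_grp (gcd n 3)) \<in> ?C"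
  proof (cases "3 dvd n")
    case True
    then have "gcd n 3 = 3" by (simp add: gcd_nat.absorb2)
    moreover obtain g where "orthogonal_matrix g" "conj_class (pullback n g) = conj_class (Z_grp 3)"
      using exists_pullback_Z3[OF assms True] by blast
    ultimately show ?thesis
      using in_C[of g] by (simp only:)
  next
    case False
    have "prime (3::nat)" by simp
    then have "coprime 3 n"
      using False by (rule prime_imp_coprime)
    then have "gcd n 3 = 1"
      by (simp add: coprime_iff_gcd_eq_1 gcd.commute)
    moreover have "Z_grp 1 = trivial_group"
      by (simp only: Z_grp_1 trivial_group_def)
    ultimately show ?thesis using triv by (simp only:)
  qed
  have D2: "conj_class (D_grp (gcd n 2)) \<in> ?C"
  proof (cases "even n")
    case True
    then have "gcd n 2 = 2" by (simp add: gcd_nat.absorb2)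
    moreover obtain g where "orthogonal_matrix g" "pullback n g = D_grp 2"
      using exists_pullback_D2[OF assms True] by blast
    ultimately show ?thesis
      using in_C[of g] by (simp only:)
  next
    case False
    then have "coprime n 2" by simp
    then have "gcd n 2 = 1"
      by (simp only: coprime_iff_gcd_eq_1)
    then show ?thesis
      using Z2 by (simp only: D_grp_1)
  qed
  have D2z: "conj_class D2_z \<in> ?C"
  proof -
    obtain g where "orthogonal_matrix g" "conj_class (pullback n g) = conj_class D2_z"
      using exists_pullback_D2_z[OF assms] by blast
    then show ?thesis using in_C[of g] by (simp only:)
  qed
  have "?C \<subseteq> {conj_class trivial_group, conj_class (Z_grp 2), conj_class (Z_grp (gcd n 3)),
     conj_class (D_grp (gcd n 2)), conj_class Z2_minus, conj_class D2_z}"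
    using conj_class_pullback_in[OF assms] by blast
  with triv Z2 Z3 D2 Z2m D2z show ?thesis
    unfolding clips_pullback by (intro equalityI) (simp_all only: insert_subset empty_subsetI simp_thms)
qed

end
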